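(* Let $X_1,\dots,X_n$ be independent, non-constant random variables with $\mathbb{E}(\psi_i(X_i)^2)<\infty$ for $1\le i\le n$, and let $\mathbf{X}^{(1)},\dots,\mathbf{X}^{(N)}$ be independent copies of $\mathbf{X}=(X_1,\dots,X_n)$. Put $${}^N\!h:=\prod_{i=1}^n{}^N\!h_i,\qquad {}^N\!h_i:=\frac1{N^2}\sum_{j,k=1}^N\psi_i(X_i^{(j)}-X_i^{(k)}).$$ Then $$\mathbb{E}\left(N\cdot\frac{{}^N\!M_\rho^2(\mathbf{X}^{(1)},\dots,\mathbf{X}^{(N)})}{{}^N\!h}\right)=1+(N-1)\left(\frac{-1}{N-1}\right)^n=1-\left(\frac{-1}{N-1}\right)^{n-1},$$ $$\mathbb{E}\left(\left[N\cdot\frac{{}^N\!M_\rho^2(\mathbf{X}^{(1)},\dots,\mathbf{X}^{(N)})}{{}^N\!h}\right]^2\right)=\frac1{N^2}\sum_{k=1}^7C(N,k)\prod_{i=1}^n\left[\frac{b(N,k)b_{i,N}+c(N,k)c_{i,N}+d(N,k)d_{i,N}}{N^4}\right],$$ where, with $X_i,X_i',X_i'',X_i'''$ standing for the distinct sample members $X_i^{(1)},X_i^{(2)},X_i^{(3)},X_i^{(4)}$, $$b_{i,N}:=\mathbb{E}\Bigl(\frac{\psi_i(X_i-X_i')^2}{({}^N\!h_i)^2}\Bigr),\quad c_{i,N}:=\mathbb{E}\Bigl(\frac{\psi_i(X_i-X_i')\psi_i(X_i'-X_i'')}{({}^N\!h_i)^2}\Bigr),\quad d_{i,N}:=\mathbb{E}\Bigl(\frac{\psi_i(X_i-X_i')\psi_i(X_i''-X_i''')}{({}^N\!h_i)^2}\Bigr),$$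 and the coefficients $C(N,k),b(N,k),c(N,k),d(N,k)$ are the following: $k=1$: $C=N(N-1)(N-2)(N-3)$, $b=6N+2N^2$, $c=-24N-4N^2$, $d=18N+3N^2$; $k=2$: $C=2N(N-1)$, $b=6N-2N^2-2N^3+N^4$, $c=-24N+12N^2+4N^3-2N^4$, $d=18N-9N^2-2N^3+N^4$; $k=3$: $C=4N(N-1)(N-2)$, $b=6N-N^3$, $c=-24N+4N^2+2N^3$, $d=18N-3N^2-N^3$; $k=4$: $C=N(N-1)$, $b=6N-2N^2$, $c=-24N+12N^2$, $d=18N-9N^2-2N^3+N^4$; $k=5$: $C=4N(N-1)$, $b=6N-4N^2$, $c=-24N+20N^2-4N^3$, $d=18N-15N^2+3N^3$; $k=6$: $C=2N(N-1)(N-2)$, $b=6N$, $c=-24N+4N^2$, $d=18N-3N^2-N^3$; $k=7$: $C=N$, $b=6N-10N^2+4N^3$, $c=-24N+44N^2-24N^3+4N^4$, $d=18N-33N^2+18N^3-3N^4$.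
   Context: Each $X_i$ takes values in $\mathbb{R}^{d_i}$, and $N$ is the sample size. For each $i$, $\rho_i$ is a symmetric measure with full support on $\mathbb{R}^{d_i}$ with $\int 1\wedge|t_i|^2\,\rho_i(dt_i)<\infty$; $\rho=\bigotimes_{i=1}^n\rho_i$ and $\psi_i(x_i)=\int_{\mathbb{R}^{d_i}}1-\cos(x_i\cdot t_i)\,\rho_i(dt_i)$. Sample distance multivariance ${}^N\!M_\rho\ge 0$ is defined by ${}^N\!M_\rho^2(\mathbf{x}^{(1)},\dots,\mathbf{x}^{(N)})=\int|{}^N\!Z(t)|^2\,\rho(dt)$ with ${}^N\!Z(t)=\frac1N\sum_{l=1}^N\prod_{i=1}^n\bigl(e^{\mathrm{i}x_i^{(l)}\cdot t_i}-\frac1N\sum_{k=1}^Ne^{\mathrm{i}x_i^{(k)}\cdot t_i}\bigr)$; equivalently, $${}^N\!M_\rho^2(\mathbf{x}^{(1)},\dots,\mathbf{x}^{(N)})=\frac1{N^2}\sum_{j,k=1}^N\prod_{i=1}^n(A_i)_{j,k},\qquad A_i=-HB_iH,\quad H=I-\tfrac1N\mathbf{1},\quad B_i=\bigl(\psi_i(x_i^{(j)}-x_i^{(k)})\bigr)_{j,k=1,\dots,N},$$ where $I$ is the $N\times N$ identity matrix and $\mathbf{1}$ the $N\times N$ all-ones matrix.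
   Formalization: If the normalization h vanishes with positive probability (X_i with atoms), the quotients are undefined; all expectations, including those in b_{i,N}, c_{i,N}, d_{i,N}, are then conditional on h ≠ 0. If h ≠ 0 almost surely they are the ordinary ones. The ρ_i are taken sigma-finite, and N ≥ 2. *)

theory Defs
  imports "HOL-Probability.Probability"
begin

text \<open>Since the dimension \<^term>\<open>d i\<close> depends on the index of the random variable, a vector of
  the \<open>d\<close>-dimensional Euclidean space is a function \<^typ>\<open>nat \<Rightarrow> real\<close> that is extensional
  on \<open>{..<d}\<close>. Only the space and the Borel sets of \<open>Rd d\<close> matter.\<close>

definition Rd :: "nat \<Rightarrow> (nat \<Rightarrow> real) measure" where
  "Rd d = (\<Pi>\<^sub>M m\<in>{..<d}. borel)"

definition dot :: "nat \<Rightarrow> (nat \<Rightarrow> real) \<Rightarrow> (nat \<Rightarrow> real) \<Rightarrow> real" where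
  "dot d x t = (\<Sum>m<d. x m * t m)"

definition vdiff :: "nat \<Rightarrow> (nat \<Rightarrow> real) \<Rightarrow> (nat \<Rightarrow> real) \<Rightarrow> nat \<Rightarrow> real" where
  "vdiff d x y = (\<lambda>m\<in>{..<d}. x m - y m)"

text \<open>Sigma-finiteness is what makes the product of the measures meaningful; in view of the
  integrability condition it only excludes an infinite atom at the origin, where
  \<open>1 \<and> |t|\<^sup>2\<close> vanishes.\<close>

definition admissible_measure :: "nat \<Rightarrow> (nat \<Rightarrow> real) measure \<Rightarrow> bool" where
  "admissible_measure d \<rho> \<longleftrightarrow>
     sets \<rho> = sets (Rd d) \<and>
     sigma_finite_measure \<rho> \<and>
     distr \<rho> (Rd d) (\<lambda>t. \<lambda>m\<in>{..<d}. - t m) = \<rho> \<and>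
     (\<forall>U. openin (powertop_real {..<d}) U \<and> U \<noteq> {} \<longrightarrow> emeasure \<rho> U > 0) \<and>
     (\<integral>\<^sup>+ t. ennreal (min 1 ((L2_set t {..<d})\<^sup>2)) \<partial>\<rho>) < \<infinity>"

definition psi :: "nat \<Rightarrow> (nat \<Rightarrow> real) measure \<Rightarrow> (nat \<Rightarrow> real) \<Rightarrow> real" where
  "psi d \<rho> x = (\<integral>t. 1 - cos (dot d x t) \<partial>\<rho>)"

text \<open>In a sample \<open>x\<close>, the vector \<open>x l i\<close> is the \<open>i\<close>-th component of the \<open>l\<close>-th sample member;
  the indices run through \<open>l \<in> {1..N}\<close> and \<open>i \<in> {1..n}\<close>.\<close>

definition sample_Z ::
  "(nat \<Rightarrow> nat) \<Rightarrow> nat \<Rightarrow> nat \<Rightarrow> (nat \<Rightarrow> nat \<Rightarrow> nat \<Rightarrow> real) \<Rightarrow> (nat \<Rightarrow> nat \<Rightarrow> real) \<Rightarrow> complex" where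
  "sample_Z d n N x t =
     (1 / of_nat N) * (\<Sum>l=1..N. \<Prod>i=1..n.
        (exp (\<i> * of_real (dot (d i) (x l i) (t i)))
         - (1 / of_nat N) * (\<Sum>k=1..N. exp (\<i> * of_real (dot (d i) (x k i) (t i))))))"

definition sample_multivariance ::
  "(nat \<Rightarrow> nat) \<Rightarrow> (nat \<Rightarrow> (nat \<Rightarrow> real) measure) \<Rightarrow> nat \<Rightarrow> nat \<Rightarrow> (nat \<Rightarrow> nat \<Rightarrow> nat \<Rightarrow> real) \<Rightarrow> real" where
  "sample_multivariance d \<rho> n N x =
     sqrt (\<integral>t. (cmod (sample_Z d n N x t))\<^sup>2 \<partial>(\<Pi>\<^sub>M i\<in>{1..n}. \<rho> i))"

definition sample_h_comp ::
  "(nat \<Rightarrow> nat) \<Rightarrow> (nat \<Rightarrow> (nat \<Rightarrow> real) measure) \<Rightarrow> nat \<Rightarrow> (nat \<Rightarrow> nat \<Rightarrow> nat \<Rightarrow> real) \<Rightarrow> nat \<Rightarrow> real" where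
  "sample_h_comp d \<rho> N x i =
     (1 / (real N)\<^sup>2) * (\<Sum>j=1..N. \<Sum>k=1..N. psi (d i) (\<rho> i) (vdiff (d i) (x j i) (x k i)))"

definition sample_h ::
  "(nat \<Rightarrow> nat) \<Rightarrow> (nat \<Rightarrow> (nat \<Rightarrow> real) measure) \<Rightarrow> nat \<Rightarrow> nat \<Rightarrow> (nat \<Rightarrow> nat \<Rightarrow> nat \<Rightarrow> real) \<Rightarrow> real" where
  "sample_h d \<rho> n N x = (\<Prod>i=1..n. sample_h_comp d \<rho> N x i)"

text \<open>The probability measure with respect to which a random variable that makes sense only on
  the event \<open>A\<close> (such as a quotient, on the event that its denominator does not vanish) has
  its expectation: \<open>M\<close> itself if \<open>A\<close> has probability one, and the conditional probability
  given \<open>A\<close> otherwise. The second case is needed for laws with atoms: all sample members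
  may then coincide with positive probability, and with them the normalization is zero.\<close>

definition law_on :: "'w measure \<Rightarrow> 'w set \<Rightarrow> 'w measure" where
  "law_on M A = (if AE \<omega> in M. \<omega> \<in> A then M else uniform_measure M A)"

text \<open>In all lists below, entry number \<open>k\<close>, counting from one, belongs to the coefficient with
  index \<open>k\<close>; the first argument is the sample size.\<close>

definition coef_C :: "real \<Rightarrow> nat \<Rightarrow> real" where
  "coef_C N k =
    [N * (N - 1) * (N - 2) * (N - 3),
     2 * N * (N - 1),
     4 * N * (N - 1) * (N - 2),
     N * (N - 1),
     4 * N * (N - 1),
     2 * N * (N - 1) * (N - 2),
     N] ! (k - 1)"

definition coef_b :: "real \<Rightarrow> nat \<Rightarrow> real" where
  "coef_b N k =
    [6 * N + 2 * N^2,
     6 * N - 2 * N^2 - 2 * N^3 + N^4,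
     6 * N - N^3,
     6 * N - 2 * N^2,
     6 * N - 4 * N^2,
     6 * N,
     6 * N - 10 * N^2 + 4 * N^3] ! (k - 1)"

definition coef_c :: "real \<Rightarrow> nat \<Rightarrow> real" where
  "coef_c N k =
    [- 24 * N - 4 * N^2,
     - 24 * N + 12 * N^2 + 4 * N^3 - 2 * N^4,
     - 24 * N + 4 * N^2 + 2 * N^3,
     - 24 * N + 12 * N^2,
     - 24 * N + 20 * N^2 - 4 * N^3,
     - 24 * N + 4 * N^2,
     - 24 * N + 44 * N^2 - 24 * N^3 + 4 * N^4] ! (k - 1)"

definition coef_d :: "real \<Rightarrow> nat \<Rightarrow> real" where
  "coef_d N k =
    [18 * N + 3 * N^2,
     18 * N - 9 * N^2 - 2 * N^3 + N^4,
     18 * N - 3 * N^2 - N^3,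
     18 * N - 9 * N^2 - 2 * N^3 + N^4,
     18 * N - 15 * N^2 + 3 * N^3,
     18 * N - 3 * N^2 - N^3,
     18 * N - 33 * N^2 + 18 * N^3 - 3 * N^4] ! (k - 1)"

end

theory Submission
  imports Defs "HOL-Combinatorics.Permutations"
begin

text \<open>Expanding \<open>|Z|\<^sup>2\<close> and integrating coordinatewise turns the quotient into
  \<open>1/N \<Sum>\<^sub>j\<^sub>k \<Prod>\<^sub>i G\<^sub>i(j, k)\<close>, where \<open>G\<^sub>i = - H R\<^sub>i H\<close> and \<open>R\<^sub>i\<close> is the matrix of the
  \<open>\<psi>\<^sub>i(X\<^sub>i\<^sup>(\<^sup>p\<^sup>) - X\<^sub>i\<^sup>(\<^sup>q\<^sup>))\<close> divided by the \<open>i\<close>-th normalization. The entries of \<open>R\<^sub>i\<close> are bounded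
  by \<open>N\<^sup>2\<close>. The event that the normalization vanishes is a union over \<open>i\<close> of events that
  depend only on the \<open>i\<close>-th components and are invariant under permutations of the sample; hence
  under the conditional law the components are still independent, and each of them is still
  exchangeable. So all expectations factor over \<open>i\<close>, and the expectation of
  \<open>R\<^sub>i(p, q) R\<^sub>i(r, s)\<close> depends only on which of the indices coincide. Written in Kronecker
  symbols, it is annihilated by the centering \<open>H\<close> up to the terms
  \<open>\<delta>\<^sub>p\<^sub>q \<delta>\<^sub>r\<^sub>s\<close>, \<open>\<delta>\<^sub>p\<^sub>r \<delta>\<^sub>q\<^sub>s\<close>, \<open>\<delta>\<^sub>p\<^sub>s \<delta>\<^sub>q\<^sub>r\<close> and \<open>\<delta>\<^sub>p\<^sub>q\<^sub>r\<^sub>s\<close>; evaluating these for the seven patterns of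
  \<open>(j, k, l, m)\<close> gives the coefficients. The same argument with two indices, together with
  \<open>\<Sum>\<^sub>p\<^sub>q R\<^sub>i(p, q) = N\<^sup>2\<close>, gives the first moment.\<close>

section \<open>The representation by centered matrices\<close>

lemma sets_Rd_cong [measurable_cong]: "sets (Rd d) = sets (\<Pi>\<^sub>M m\<in>{..<d}. borel)"
  by (simp add: Rd_def)

lemma space_Rd: "space (Rd d) = extensional {..<d}"
  by (simp add: Rd_def space_PiM PiE_UNIV_domain PiE_def)

lemma dot_measurable [measurable]: "dot d x \<in> borel_measurable (Rd d)"
proof -
  have "(\<lambda>t. x m * t m) \<in> borel_measurable (Rd d)" if "m < d" for m
    unfolding Rd_def using that by (intro borel_measurable_times measurable_component_singleton) auto
  then show ?thesis unfolding dot_def by measurable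
qed

lemma dot_measurable_pair [measurable]:
  "(\<lambda>(x, t). dot d x t) \<in> borel_measurable (Rd d \<Otimes>\<^sub>M Rd d)"
proof -
  have "(\<lambda>p. fst p m * snd p m) \<in> borel_measurable (Rd d \<Otimes>\<^sub>M Rd d)" if "m < d" for m
    unfolding Rd_def using that
    by (intro borel_measurable_times measurable_compose[OF measurable_fst measurable_component_singleton]
        measurable_compose[OF measurable_snd measurable_component_singleton]) auto
  then show ?thesis unfolding dot_def split_beta by measurable
qed

lemma vdiff_measurable [measurable]:
  "(\<lambda>(x, y). vdiff d x y) \<in> Rd d \<Otimes>\<^sub>M Rd d \<rightarrow>\<^sub>M Rd d"
  unfolding vdiff_def Rd_def split_beta
  by (rule measurable_restrict) measurable

lemma reflection_measurable [measurable]: "(\<lambda>t. \<lambda>m\<in>{..<d}. - t m :: real) \<in> Rd d \<rightarrow>\<^sub>M Rd d"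
  unfolding Rd_def by (rule measurable_restrict) measurable

lemma dot_vdiff: "dot d (vdiff d x y) t = dot d x t - dot d y t"
  by (simp add: dot_def vdiff_def sum_subtractf left_diff_distrib)

lemma dot_reflection: "dot d x (\<lambda>m\<in>{..<d}. - t m) = - dot d x t"
  by (simp add: dot_def sum_negf)

lemma one_minus_cos_le: "1 - cos u \<le> u\<^sup>2 / 2" for u :: real
proof -
  have "1 - cos u = 2 * (sin (u / 2))\<^sup>2"
    using cos_double_sin[of "u / 2"] by simp
  also have "\<dots> \<le> 2 * (u / 2)\<^sup>2"
    using abs_sin_x_le_abs_x[of "u / 2"] unfolding abs_le_square_iff by simp
  finally show ?thesis by (simp add: power2_eq_square)
qed

text \<open>One constant covers two regimes: for small \<open>t\<close>, Cauchy-Schwarz and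
  \<open>one_minus_cos_le\<close> give a bound quadratic in \<open>t\<close>; for large
  \<open>t\<close>, \<open>1 - cos\<close> never exceeds 2. The integrability condition on the
  measure thereby controls the integrand of \<open>psi\<close>.\<close>

lemma one_minus_cos_dot_le:
  "1 - cos (dot d x t) \<le> (2 + (L2_set x {..<d})\<^sup>2) * min 1 ((L2_set t {..<d})\<^sup>2)"
proof (cases "(L2_set t {..<d})\<^sup>2 \<le> 1")
  case True
  have "\<bar>dot d x t\<bar> \<le> (\<Sum>m<d. \<bar>x m\<bar> * \<bar>t m\<bar>)"
    unfolding dot_def abs_mult [symmetric] by (rule sum_abs)
  also have "\<dots> \<le> L2_set x {..<d} * L2_set t {..<d}"
    by (rule L2_set_mult_ineq)
  finally have "(dot d x t)\<^sup>2 \<le> (L2_set x {..<d} * L2_set t {..<d})\<^sup>2"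
    by (metis abs_ge_zero power2_abs power_mono)
  then have "1 - cos (dot d x t) \<le> (L2_set x {..<d})\<^sup>2 * (L2_set t {..<d})\<^sup>2"
    using one_minus_cos_le[of "dot d x t"] zero_le_power2[of "dot d x t"]
    unfolding power_mult_distrib by linarith
  also have "\<dots> \<le> (2 + (L2_set x {..<d})\<^sup>2) * (L2_set t {..<d})\<^sup>2"
    by (intro mult_right_mono) auto
  finally show ?thesis using True by (simp add: min_absorb2)
next
  case False
  have "1 - cos (dot d x t) \<le> 2" using cos_ge_minus_one[of "dot d x t"] by linarith
  also have "\<dots> \<le> 2 + (L2_set x {..<d})\<^sup>2" by simp
  finally show ?thesis using False by simp
qed

lemma L2_set_measurable [measurable]: "(\<lambda>t. L2_set t {..<d}) \<in> borel_measurable (Rd d)"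
proof -
  have "(\<lambda>t. (t m)\<^sup>2) \<in> borel_measurable (Rd d)" if "m < d" for m
    unfolding Rd_def using that by (intro borel_measurable_power measurable_component_singleton) auto
  then show ?thesis unfolding L2_set_def by measurable
qed

section \<open>The kernel \<open>psi\<close> and its integral representation\<close>

lemma psi_nonneg: "psi d \<rho> x \<ge> 0"
  unfolding psi_def by (rule Bochner_Integration.integral_nonneg) simp

lemma psi_vdiff_self [simp]: "psi d \<rho> (vdiff d x x) = 0"
  by (simp add: psi_def dot_vdiff)

lemma psi_vdiff_commute: "psi d \<rho> (vdiff d x y) = psi d \<rho> (vdiff d y x)"
  unfolding psi_def dot_vdiff by (metis (no_types) cos_minus minus_diff_eq)

lemma cmod_diff_cis_squared: "(cmod (cis a - cis b))\<^sup>2 = 2 * (1 - cos (a - b))"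
proof -
  have "(cmod (cis a - cis b))\<^sup>2
      = ((sin a)\<^sup>2 + (cos a)\<^sup>2) + ((sin b)\<^sup>2 + (cos b)\<^sup>2) - 2 * (cos a * cos b + sin a * sin b)"
    by (simp only: cmod_power2) (simp add: power2_eq_square algebra_simps)
  then show ?thesis by (simp add: cos_diff)
qed

locale admissible =
  fixes d :: nat and \<rho> :: "(nat \<Rightarrow> real) measure"
  assumes admissible: "admissible_measure d \<rho>"
begin

lemma sets_rho [measurable_cong]: "sets \<rho> = sets (Rd d)"
  and rho_reflection: "distr \<rho> (Rd d) (\<lambda>t. \<lambda>m\<in>{..<d}. - t m) = \<rho>"
  and rho_full_support:
    "openin (powertop_real {..<d}) U \<Longrightarrow> U \<noteq> {} \<Longrightarrow> emeasure \<rho> U > 0"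
  and rho_levy: "(\<integral>\<^sup>+ t. ennreal (min 1 ((L2_set t {..<d})\<^sup>2)) \<partial>\<rho>) < \<infinity>"
  using admissible by (auto simp: admissible_measure_def)

sublocale sigma_finite_measure \<rho>
  using admissible by (simp add: admissible_measure_def)

lemma one_minus_cos_integrable: "integrable \<rho> (\<lambda>t. 1 - cos (dot d x t))"
proof (rule Bochner_Integration.integrable_bound)
  have "integrable \<rho> (\<lambda>t. min 1 ((L2_set t {..<d})\<^sup>2))"
    using rho_levy by (intro integrableI_nonneg) auto
  then show "integrable \<rho> (\<lambda>t. (2 + (L2_set x {..<d})\<^sup>2) * min 1 ((L2_set t {..<d})\<^sup>2))"
    by simp
  show "AE t in \<rho>. norm (1 - cos (dot d x t))
      \<le> norm ((2 + (L2_set x {..<d})\<^sup>2) * min 1 ((L2_set t {..<d})\<^sup>2))"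
    using one_minus_cos_dot_le by (intro always_eventually) (auto intro: order_trans[OF _ abs_ge_self])
qed measurable

lemma psi_measurable [measurable]: "psi d \<rho> \<in> borel_measurable (Rd d)"
proof -
  have "(\<lambda>(x, t). 1 - cos (dot d x t)) \<in> borel_measurable (Rd d \<Otimes>\<^sub>M \<rho>)"
    using dot_measurable_pair[of d] by (simp add: split_beta) measurable
  then show ?thesis
    unfolding psi_def[abs_def] by (rule borel_measurable_lebesgue_integral)
qed

text \<open>A vanishing integral of the nonnegative integrand would make the open set where it is
  positive a null set. Full support forbids this as soon as that set is nonempty.\<close>

lemma psi_pos:
  assumes "m < d" "x m \<noteq> 0"
  shows "psi d \<rho> x > 0"
proof (rule ccontr)
  assume "\<not> psi d \<rho> x > 0"
  then have "(\<integral>t. 1 - cos (dot d x t) \<partial>\<rho>) = 0"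
    using psi_nonneg[of d \<rho> x] unfolding psi_def by linarith
  then have "AE t in \<rho>. 1 - cos (dot d x t) = 0"
    by (subst (asm) integral_nonneg_eq_0_iff_AE) (auto intro: one_minus_cos_integrable)
  moreover define U where "U = {t \<in> topspace (powertop_real {..<d}). 1 - cos (dot d x t) \<in> {0<..}}"
  have "topspace (powertop_real {..<d}) = space \<rho>"
    unfolding sets_eq_imp_space_eq[OF sets_rho] space_Rd by (simp add: PiE_def)
  then have U_eq: "U = {t \<in> space \<rho>. 1 - cos (dot d x t) > 0}"
    by (simp add: U_def)
  ultimately have "emeasure \<rho> U = 0"
    by (auto simp: U_eq intro!: emeasure_eq_0_AE elim: eventually_mono)
  moreover have "openin (powertop_real {..<d}) U"
    unfolding U_def
  proof (rule openin_continuous_map_preimage)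
    have "continuous_map (powertop_real {..<d}) euclideanreal (dot d x)"
      unfolding dot_def
      by (intro continuous_map_sum continuous_map_real_mult continuous_map_const[THEN iffD2])
         (auto intro: continuous_map_product_projection)
    then have "continuous_map (powertop_real {..<d}) euclideanreal ((\<lambda>u. 1 - cos u) \<circ> dot d x)"
      by (rule continuous_map_compose) (auto intro!: continuous_intros)
    then show "continuous_map (powertop_real {..<d}) euclideanreal (\<lambda>t. 1 - cos (dot d x t))"
      by (simp add: comp_def)
  qed simp
  \<comment> \<open>This point has inner product \<open>pi\<close> with \<open>x\<close>, where
    \<open>1 - cos\<close> takes its maximal value 2.\<close>
  moreover have "(\<lambda>k\<in>{..<d}. if k = m then pi / x m else 0) \<in> U"
  proof -
    have "dot d x (\<lambda>k\<in>{..<d}. if k = m then pi / x m else 0) = (\<Sum>k<d. if k = m then pi else 0)"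
      unfolding dot_def using assms(2) by (intro sum.cong) auto
    then show ?thesis using assms(1) by (simp add: U_def)
  qed
  ultimately show False
    using rho_full_support[of U] by auto
qed

text \<open>Turns a vanishing kernel into equality of vectors. It serves to show that an almost
  surely vanishing normalization would force a component to be constant.\<close>

lemma psi_vdiff_eq_0_iff:
  assumes "x \<in> space (Rd d)" "y \<in> space (Rd d)"
  shows "psi d \<rho> (vdiff d x y) = 0 \<longleftrightarrow> x = y"
proof
  assume *: "psi d \<rho> (vdiff d x y) = 0"
  show "x = y"
  proof (rule extensionalityI)
    fix m assume "m \<in> {..<d}"
    then show "x m = y m" using psi_pos[of m "vdiff d x y"] * by (auto simp: vdiff_def)
  qed (use assms in \<open>simp_all add: space_Rd\<close>)
qed simp

text \<open>The single exponentials need not be integrable, and the imaginary part of the product need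
  not be a sum of integrable terms either; it drops out by the symmetry of the measure.\<close>

lemma has_bochner_integral_cis_diff_mult:
  "has_bochner_integral \<rho>
     (\<lambda>t. (cis (dot d x t) - cis (dot d y t)) * cnj (cis (dot d u t) - cis (dot d v t)))
     (of_real (psi d \<rho> (vdiff d x v) + psi d \<rho> (vdiff d y u)
        - psi d \<rho> (vdiff d x u) - psi d \<rho> (vdiff d y v)))"
proof -
  define f where "f t = (cis (dot d x t) - cis (dot d y t)) * cnj (cis (dot d u t) - cis (dot d v t))" for t
  have [measurable]: "f \<in> borel_measurable (Rd d)"
    unfolding f_def by (subst borel_measurable_complex_iff) simp
  have int: "integrable \<rho> f"
  \<comment> \<open>Domination by \<open>2 * |z| * |w| \<le> |z|^2 + |w|^2\<close>, where each
    squared difference of exponentials equals \<open>2 * (1 - cos)\<close>.\<close>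
  proof (rule Bochner_Integration.integrable_bound)
    show "integrable \<rho> (\<lambda>t. (1 - cos (dot d (vdiff d x y) t)) + (1 - cos (dot d (vdiff d u v) t)))"
      by (intro Bochner_Integration.integrable_add one_minus_cos_integrable)
    have "norm (f t) \<le> (1 - cos (dot d (vdiff d x y) t)) + (1 - cos (dot d (vdiff d u v) t))" for t
      using sum_squares_bound[of "cmod (cis (dot d x t) - cis (dot d y t))"
          "cmod (cis (dot d u t) - cis (dot d v t))"]
      by (simp add: f_def norm_mult cmod_diff_cis_squared dot_vdiff flip: complex_cnj_diff)
    then show "AE t in \<rho>. norm (f t)
        \<le> norm ((1 - cos (dot d (vdiff d x y) t)) + (1 - cos (dot d (vdiff d u v) t)))"
      by (intro always_eventually) (auto intro: order_trans[OF _ abs_ge_self])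
  qed measurable
  \<comment> \<open>Reflecting \<open>t\<close> conjugates \<open>f\<close>, so the integral equals
    its own conjugate.\<close>
  have "(\<integral>t. f t \<partial>\<rho>) = (\<integral>t. f t \<partial>distr \<rho> (Rd d) (\<lambda>t. \<lambda>m\<in>{..<d}. - t m))"
    by (simp only: rho_reflection)
  also have "\<dots> = (\<integral>t. cnj (f t) \<partial>\<rho>)"
    by (subst integral_distr) (auto simp: f_def dot_reflection cis_cnj)
  finally have Im: "Im (\<integral>t. f t \<partial>\<rho>) = 0"
    by (simp add: complex_eq_iff)
  \<comment> \<open>The four cosines carry two plus and two minus signs, so that the ones can be
    inserted freely; each summand is then integrable by itself.\<close>
  have "Re (f t) = (1 - cos (dot d (vdiff d x v) t)) + (1 - cos (dot d (vdiff d y u) t))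
      - (1 - cos (dot d (vdiff d x u) t)) - (1 - cos (dot d (vdiff d y v) t))" for t
    by (simp add: f_def dot_vdiff cos_diff algebra_simps)
  then have "Re (\<integral>t. f t \<partial>\<rho>) = psi d \<rho> (vdiff d x v) + psi d \<rho> (vdiff d y u)
        - psi d \<rho> (vdiff d x u) - psi d \<rho> (vdiff d y v)"
    unfolding integral_Re[OF int, symmetric] psi_def
    by (simp only: Bochner_Integration.integral_add Bochner_Integration.integral_diff
        Bochner_Integration.integrable_add Bochner_Integration.integrable_diff one_minus_cos_integrable)
  with Im int show ?thesis
    unfolding f_def[symmetric] by (simp add: has_bochner_integral_iff complex_eq_iff)
qed

end

section \<open>Double centering and the matrix form of sample multivariance\<close>

lemma sum_centering_mult:
  assumes "k \<in> {1..N}"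
  shows "(\<Sum>q=1..N. (of_bool (k = q) - 1 / real N) * f q) = f k - (\<Sum>q=1..N. f q) / real N"
proof -
  have "(\<Sum>q=1..N. of_bool (k = q) * f q) = (\<Sum>q=1..N. if k = q then f q else 0)"
    by (intro sum.cong) auto
  then have "(\<Sum>q=1..N. of_bool (k = q) * f q) = f k"
    using assms by simp
  then show ?thesis
    by (simp add: left_diff_distrib sum_subtractf sum_divide_distrib)
qed

text \<open>The entries of \<open>A = - H B H\<close> in the notation of the paper.\<close>

definition centered_entry :: "nat \<Rightarrow> (nat \<Rightarrow> nat \<Rightarrow> real) \<Rightarrow> nat \<Rightarrow> nat \<Rightarrow> real" where
  "centered_entry N B j k =
     - (\<Sum>p=1..N. \<Sum>q=1..N. (of_bool (j = p) - 1 / real N) * (of_bool (k = q) - 1 / real N) * B p q)"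

text \<open>The bracket is the four-term combination of
  \<open>has_bochner_integral_cis_diff_mult\<close>. Averaging it over \<open>p\<close> and
  \<open>q\<close> is the same as centering both indices, which links the integral to the matrix
  form.\<close>

lemma centered_entry_eq_average:
  assumes "j \<in> {1..N}" "k \<in> {1..N}"
  shows "centered_entry N B j k
    = 1 / (real N)\<^sup>2 * (\<Sum>p=1..N. \<Sum>q=1..N. B j q + B p k - B j k - B p q)"
proof -
  have N: "real N \<noteq> 0" using assms by auto
  have "(\<Sum>p=1..N. \<Sum>q=1..N. (of_bool (j = p) - 1 / real N) * (of_bool (k = q) - 1 / real N) * B p q)
      = (\<Sum>p=1..N. (of_bool (j = p) - 1 / real N) * (B p k - (\<Sum>q=1..N. B p q) / N))"
    unfolding mult.assoc sum_distrib_left[symmetric] sum_centering_mult[OF assms(2)] ..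
  also have "\<dots> = B j k - (\<Sum>q=1..N. B j q) / N
      - ((\<Sum>p=1..N. B p k) / N - (\<Sum>p=1..N. \<Sum>q=1..N. B p q) / N / N)"
    unfolding sum_centering_mult[OF assms(1)] by (simp add: sum_subtractf sum_divide_distrib diff_divide_distrib)
  finally have *: "(\<Sum>p=1..N. \<Sum>q=1..N.
      (of_bool (j = p) - 1 / real N) * (of_bool (k = q) - 1 / real N) * B p q)
      = B j k - (\<Sum>q=1..N. B j q) / N
      - ((\<Sum>p=1..N. B p k) / N - (\<Sum>p=1..N. \<Sum>q=1..N. B p q) / N / N)" .
  show ?thesis
    unfolding centered_entry_def * using N
    by (simp add: sum.distrib sum_subtractf flip: sum_distrib_left)
       (simp add: divide_simps power2_eq_square, simp add: algebra_simps)
qed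

text \<open>The square of the modulus of \<open>sample_Z\<close> is a double sum over
  \<open>j\<close> and \<open>k\<close> of products whose \<open>i\<close>-th factor depends on
  \<open>t i\<close> alone. The integral over the product measure therefore factors, and each factor
  is an entry of the centered matrix.\<close>

lemma sample_multivariance_squared:
  assumes adm: "\<And>i. i \<in> {1..n} \<Longrightarrow> admissible_measure (d i) (\<rho> i)" and N: "N > 0"
  shows "(sample_multivariance d \<rho> n N x)\<^sup>2 = 1 / (real N)\<^sup>2 * (\<Sum>j=1..N. \<Sum>k=1..N. \<Prod>i=1..n.
    centered_entry N (\<lambda>p q. psi (d i) (\<rho> i) (vdiff (d i) (x p i) (x q i))) j k)"
proof -
  define \<phi> where "\<phi> i j \<tau> = cis (dot (d i) (x j i) \<tau>)
      - (1 / of_nat N) * (\<Sum>k=1..N. cis (dot (d i) (x k i) \<tau>))" for i j \<tau>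
  define A where "A i = centered_entry N (\<lambda>p q. psi (d i) (\<rho> i) (vdiff (d i) (x p i) (x q i)))" for i
  \<comment> \<open>An average of differences of exponentials, because only products of such
    differences are known to be integrable.\<close>
  have \<phi>_eq: "\<phi> i j \<tau> = (1 / of_nat N) *
      (\<Sum>p=1..N. cis (dot (d i) (x j i) \<tau>) - cis (dot (d i) (x p i) \<tau>))" for i j \<tau>
    using N by (simp add: \<phi>_def sum_subtractf field_simps)
  have int: "has_bochner_integral (\<rho> i) (\<lambda>\<tau>. \<phi> i j \<tau> * cnj (\<phi> i k \<tau>)) (of_real (A i j k))"
    if i: "i \<in> {1..n}" and jk: "j \<in> {1..N}" "k \<in> {1..N}" for i j k
  proof -
    interpret admissible "d i" "\<rho> i" by standard (rule adm[OF i])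
    have "has_bochner_integral (\<rho> i) (\<lambda>\<tau>. 1 / (of_nat N)\<^sup>2 * (\<Sum>p=1..N. \<Sum>q=1..N.
        (cis (dot (d i) (x j i) \<tau>) - cis (dot (d i) (x p i) \<tau>))
        * cnj (cis (dot (d i) (x k i) \<tau>) - cis (dot (d i) (x q i) \<tau>))))
      (1 / (of_nat N)\<^sup>2 * (\<Sum>p=1..N. \<Sum>q=1..N. of_real
        (psi (d i) (\<rho> i) (vdiff (d i) (x j i) (x q i)) + psi (d i) (\<rho> i) (vdiff (d i) (x p i) (x k i))
        - psi (d i) (\<rho> i) (vdiff (d i) (x j i) (x k i)) - psi (d i) (\<rho> i) (vdiff (d i) (x p i) (x q i)))))"
      by (intro has_bochner_integral_mult_right has_bochner_integral_sum has_bochner_integral_cis_diff_mult)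
    also have "(\<lambda>\<tau>. 1 / (of_nat N)\<^sup>2 * (\<Sum>p=1..N. \<Sum>q=1..N.
        (cis (dot (d i) (x j i) \<tau>) - cis (dot (d i) (x p i) \<tau>))
        * cnj (cis (dot (d i) (x k i) \<tau>) - cis (dot (d i) (x q i) \<tau>))))
        = (\<lambda>\<tau>. \<phi> i j \<tau> * cnj (\<phi> i k \<tau>))"
      unfolding \<phi>_eq sum_product[symmetric] complex_cnj_mult cnj_sum
      by (simp add: power2_eq_square)
    finally show ?thesis
      unfolding A_def centered_entry_eq_average[OF jk] by simp
  qed
  \<comment> \<open>\<open>product_sigma_finite\<close> asks for sigma-finiteness at every index,
    while the hypotheses concern \<open>{1..n}\<close> only; the other indices receive a trivial
    measure.\<close>
  define \<rho>' where "\<rho>' i = (if i \<in> {1..n} then \<rho> i else count_space {})" for i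
  interpret product_sigma_finite \<rho>'
  proof (rule product_sigma_finite.intro)
    show "sigma_finite_measure (\<rho>' i)" for i
      using adm by (auto simp: \<rho>'_def admissible_measure_def intro: sigma_finite_measure_count_space_finite)
  qed
  have PiM_\<rho>': "PiM {1..n} \<rho> = PiM {1..n} \<rho>'"
    by (rule PiM_cong) (auto simp: \<rho>'_def)
  have prod_int: "has_bochner_integral (PiM {1..n} \<rho>')
      (\<lambda>t. \<Prod>i=1..n. \<phi> i j (t i) * cnj (\<phi> i k (t i))) (of_real (\<Prod>i=1..n. A i j k))"
    if jk: "j \<in> {1..N}" "k \<in> {1..N}" for j k
  proof -
    have *: "integrable (\<rho>' i) (\<lambda>\<tau>. \<phi> i j \<tau> * cnj (\<phi> i k \<tau>))"
      "(\<integral>\<tau>. \<phi> i j \<tau> * cnj (\<phi> i k \<tau>) \<partial>\<rho>' i) = of_real (A i j k)" if "i \<in> {1..n}" for i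
      using int[OF that jk] that by (auto simp: \<rho>'_def has_bochner_integral_iff)
    have "integrable (PiM {1..n} \<rho>') (\<lambda>t. \<Prod>i=1..n. \<phi> i j (t i) * cnj (\<phi> i k (t i)))"
      by (intro product_integrable_prod * finite_atLeastAtMost)
    moreover have "(\<integral>t. (\<Prod>i=1..n. \<phi> i j (t i) * cnj (\<phi> i k (t i))) \<partial>PiM {1..n} \<rho>') = of_real (\<Prod>i=1..n. A i j k)"
      by (subst product_integral_prod) (simp_all add: *)
    ultimately show ?thesis
      unfolding has_bochner_integral_iff ..
  qed
  have Z: "complex_of_real ((cmod (sample_Z d n N x t))\<^sup>2)
      = 1 / (of_nat N)\<^sup>2 * (\<Sum>j=1..N. \<Sum>k=1..N. \<Prod>i=1..n. \<phi> i j (t i) * cnj (\<phi> i k (t i)))" for t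
  proof -
    have "sample_Z d n N x t = (1 / of_nat N) * (\<Sum>l=1..N. \<Prod>i=1..n. \<phi> i l (t i))"
      by (simp add: sample_Z_def \<phi>_def cis_conv_exp)
    then have "complex_of_real ((cmod (sample_Z d n N x t))\<^sup>2)
        = (1 / of_nat N) * (\<Sum>l=1..N. \<Prod>i=1..n. \<phi> i l (t i))
        * ((1 / of_nat N) * (\<Sum>l=1..N. \<Prod>i=1..n. cnj (\<phi> i l (t i))))"
      by (simp only: complex_norm_square) simp
    also have "\<dots> = 1 / (of_nat N)\<^sup>2 *
        ((\<Sum>l=1..N. \<Prod>i=1..n. \<phi> i l (t i)) * (\<Sum>l=1..N. \<Prod>i=1..n. cnj (\<phi> i l (t i))))"
      by (simp add: power2_eq_square)
    finally show ?thesis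
      by (simp only: sum_product prod.distrib)
  qed
  have "complex_of_real (\<integral>t. (cmod (sample_Z d n N x t))\<^sup>2 \<partial>PiM {1..n} \<rho>)
      = (\<integral>t. 1 / (of_nat N)\<^sup>2 * (\<Sum>j=1..N. \<Sum>k=1..N. \<Prod>i=1..n. \<phi> i j (t i) * cnj (\<phi> i k (t i)))
          \<partial>PiM {1..n} \<rho>')"
    unfolding integral_complex_of_real[symmetric] Z PiM_\<rho>' ..
  also have "\<dots> = 1 / (of_nat N)\<^sup>2 * (\<Sum>j=1..N. \<Sum>k=1..N. of_real (\<Prod>i=1..n. A i j k))"
    by (intro has_bochner_integral_integral_eq has_bochner_integral_mult_right
        has_bochner_integral_sum prod_int)
  also have "\<dots> = of_real (1 / (real N)\<^sup>2 * (\<Sum>j=1..N. \<Sum>k=1..N. \<Prod>i=1..n. A i j k))"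
    by simp
  finally have *: "(\<integral>t. (cmod (sample_Z d n N x t))\<^sup>2 \<partial>PiM {1..n} \<rho>)
      = 1 / (real N)\<^sup>2 * (\<Sum>j=1..N. \<Sum>k=1..N. \<Prod>i=1..n. A i j k)"
    by (simp only: of_real_eq_iff)
  have "(sample_multivariance d \<rho> n N x)\<^sup>2 = (\<integral>t. (cmod (sample_Z d n N x t))\<^sup>2 \<partial>PiM {1..n} \<rho>)"
    by (simp add: sample_multivariance_def Bochner_Integration.integral_nonneg)
  then show ?thesis
    unfolding * A_def .
qed

section \<open>Centered sums of pair patterns\<close>

lemma sum_centering:
  assumes "k \<in> {1..N}"
  shows "(\<Sum>q=1..N. of_bool (k = q) - 1 / real N) = 0"
  using sum_centering_mult[OF assms, of "\<lambda>_. 1"] assms by simp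

text \<open>The pattern in which the entries \<open>(j, k)\<close> and \<open>(l, m)\<close> of a symmetric matrix overlap;
  the values are the indices of the coefficients.\<close>

definition pair_class :: "nat \<Rightarrow> nat \<Rightarrow> nat \<Rightarrow> nat \<Rightarrow> nat" where
  "pair_class j k l m =
    (if j = k then
       if l = m then if j = l then 7 else 4
       else if j = l \<or> j = m then 5 else 6
     else if l = m then if j = l \<or> k = l then 5 else 6
     else if j = l \<and> k = m \<or> j = m \<and> k = l then 2
     else if j = l \<or> j = m \<or> k = l \<or> k = m then 3 else 1)"

text \<open>This and the next two lemmas handle summands that are constant off one, two or three
  exceptional indices. The remaining indices are counted by a real difference, so no truncated
  subtraction occurs.\<close>

lemma sum_remove1:
  fixes f :: "'a \<Rightarrow> real"
  assumes "finite S" "\<And>x. x \<in> S - {j} \<Longrightarrow> f x = c" "j \<in> S"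
  shows "sum f S = f j + (real (card S) - 1) * c"
proof -
  have "sum f (S - {j}) = (\<Sum>x\<in>S - {j}. c)" using assms by (intro sum.cong) auto
  moreover have "card S > 0" using assms card_gt_0_iff by blast
  ultimately show ?thesis
    using assms by (simp add: sum.remove[of S j] of_nat_diff Suc_leI)
qed

lemma sum_remove2:
  fixes f :: "'a \<Rightarrow> real"
  assumes "finite S" "\<And>x. x \<in> S - {j, k} \<Longrightarrow> f x = c" "j \<in> S" "k \<in> S" "j \<noteq> k"
  shows "sum f S = f j + f k + (real (card S) - 2) * c"
proof -
  have "sum f (S - {j}) = f k + (real (card (S - {j})) - 1) * c"
    using assms by (intro sum_remove1) auto
  moreover have "card S > 0" using assms card_gt_0_iff by blast
  ultimately show ?thesis
    using assms by (simp add: sum.remove[of S j] of_nat_diff Suc_leI algebra_simps)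
qed

lemma sum_remove3:
  fixes f :: "'a \<Rightarrow> real"
  assumes "finite S" "\<And>x. x \<in> S - {j, k, l} \<Longrightarrow> f x = c" "j \<in> S" "k \<in> S" "l \<in> S"
    "j \<noteq> k" "j \<noteq> l" "k \<noteq> l"
  shows "sum f S = f j + f k + f l + (real (card S) - 3) * c"
proof -
  have "sum f (S - {j}) = f k + f l + (real (card (S - {j})) - 2) * c"
    using assms by (intro sum_remove2) auto
  moreover have "card S > 0" using assms card_gt_0_iff by blast
  ultimately show ?thesis
    using assms by (simp add: sum.remove[of S j] of_nat_diff Suc_leI algebra_simps)
qed

text \<open>\<open>coef_C (real N) \<kappa>\<close> is the number of quadruples of class
  \<open>\<kappa>\<close>. They are counted from the inside out: first \<open>m\<close> for each
  coincidence pattern of \<open>j\<close>, \<open>k\<close>, \<open>l\<close>, then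
  \<open>l\<close>, then \<open>k\<close>, then \<open>j\<close>.\<close>

lemma sum_pair_class:
  fixes g :: "nat \<Rightarrow> real"
  shows "(\<Sum>j=1..N. \<Sum>k=1..N. \<Sum>l=1..N. \<Sum>m=1..N. g (pair_class j k l m))
    = (\<Sum>\<kappa>=1..7. coef_C (real N) \<kappa> * g \<kappa>)"
proof -
  let ?S = "{1..N}"
  have m1: "(\<Sum>m=1..N. g (pair_class j j j m)) = g 7 + (real N - 1) * g 5" if "j \<in> ?S" for j
    using that by (subst sum_remove1[of _ j _ "g 5"]) (simp_all add: pair_class_def del: One_nat_def)
  have m2: "(\<Sum>m=1..N. g (pair_class j j l m)) = g 5 + g 4 + (real N - 2) * g 6"
    if "j \<in> ?S" "l \<in> ?S" "j \<noteq> l" for j l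
    using that by (subst sum_remove2[of _ j l _ "g 6"]) (simp_all add: pair_class_def del: One_nat_def)
  have m3: "(\<Sum>m=1..N. g (pair_class j k j m)) = g 5 + g 2 + (real N - 2) * g 3"
    if "j \<in> ?S" "k \<in> ?S" "j \<noteq> k" for j k
    using that by (subst sum_remove2[of _ j k _ "g 3"]) (simp_all add: pair_class_def del: One_nat_def)
  have m4: "(\<Sum>m=1..N. g (pair_class j k k m)) = g 2 + g 5 + (real N - 2) * g 3"
    if "j \<in> ?S" "k \<in> ?S" "j \<noteq> k" for j k
    using that by (subst sum_remove2[of _ j k _ "g 3"]) (simp_all add: pair_class_def del: One_nat_def)
  have m5: "(\<Sum>m=1..N. g (pair_class j k l m)) = g 3 + g 3 + g 6 + (real N - 3) * g 1"
    if "j \<in> ?S" "k \<in> ?S" "l \<in> ?S" "j \<noteq> k" "j \<noteq> l" "k \<noteq> l" for j k l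
    using that by (subst sum_remove3[of _ j k l _ "g 1"]) (simp_all add: pair_class_def del: One_nat_def)
  have l1: "(\<Sum>l=1..N. \<Sum>m=1..N. g (pair_class j j l m))
      = g 7 + (real N - 1) * g 5 + (real N - 1) * (g 5 + g 4 + (real N - 2) * g 6)"
    if "j \<in> ?S" for j
    using that by (subst sum_remove1[of _ j _ "g 5 + g 4 + (real N - 2) * g 6"])
      (simp_all add: m1 m2 del: One_nat_def)
  have l2: "(\<Sum>l=1..N. \<Sum>m=1..N. g (pair_class j k l m))
      = (g 5 + g 2 + (real N - 2) * g 3) + (g 2 + g 5 + (real N - 2) * g 3)
        + (real N - 2) * (g 3 + g 3 + g 6 + (real N - 3) * g 1)"
    if "j \<in> ?S" "k \<in> ?S" "j \<noteq> k" for j k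
    using that by (subst sum_remove2[of _ j k _ "g 3 + g 3 + g 6 + (real N - 3) * g 1"])
      (simp_all add: m3 m4 m5 del: One_nat_def)
  have "(\<Sum>k=1..N. \<Sum>l=1..N. \<Sum>m=1..N. g (pair_class j k l m))
      = (g 7 + (real N - 1) * g 5 + (real N - 1) * (g 5 + g 4 + (real N - 2) * g 6))
       + (real N - 1) * ((g 5 + g 2 + (real N - 2) * g 3) + (g 2 + g 5 + (real N - 2) * g 3)
        + (real N - 2) * (g 3 + g 3 + g 6 + (real N - 3) * g 1))"
    if "j \<in> ?S" for j
    using that by (subst sum_remove1[of _ j _ "(g 5 + g 2 + (real N - 2) * g 3) + (g 2 + g 5 + (real N - 2) * g 3)
        + (real N - 2) * (g 3 + g 3 + g 6 + (real N - 3) * g 1)"]) (simp_all add: l1 l2 del: One_nat_def)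
  then have "(\<Sum>j=1..N. \<Sum>k=1..N. \<Sum>l=1..N. \<Sum>m=1..N. g (pair_class j k l m))
      = real N * ((g 7 + (real N - 1) * g 5 + (real N - 1) * (g 5 + g 4 + (real N - 2) * g 6))
       + (real N - 1) * ((g 5 + g 2 + (real N - 2) * g 3) + (g 2 + g 5 + (real N - 2) * g 3)
        + (real N - 2) * (g 3 + g 3 + g 6 + (real N - 3) * g 1)))"
    by simp
  also have "\<dots> = (\<Sum>\<kappa>=1..7. coef_C (real N) \<kappa> * g \<kappa>)"
    by (simp add: coef_C_def numeral_eq_Suc) (simp add: algebra_simps)
  finally show ?thesis .
qed

text \<open>The general form of the expectation of a product of two entries of an exchangeable
  symmetric random matrix with zero diagonal: \<open>b\<close> for the same pair, \<open>c\<close>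
  for one shared index, \<open>e\<close> for disjoint pairs.\<close>

definition pair_moment :: "real \<Rightarrow> real \<Rightarrow> real \<Rightarrow> nat \<Rightarrow> nat \<Rightarrow> nat \<Rightarrow> nat \<Rightarrow> real" where
  "pair_moment b c e p q r s =
    (if p = q \<or> r = s then 0
     else if p = r \<and> q = s \<or> p = s \<and> q = r then b
     else if p = r \<or> p = s \<or> q = r \<or> q = s then c else e)"

text \<open>Needed for the term in which all four indices coincide. Each use of
  \<open>sum_centering_mult\<close> eliminates one factor. In the direct expansion the constant is
  \<open>- 4 * u^3 + N * u^4\<close>, which is \<open>- 3 * u^3\<close>.\<close>

lemma sum_centering4:
  fixes j k l m N :: nat
  defines "\<delta> \<equiv> \<lambda>p q. of_bool (p = q)"
    and "u \<equiv> 1 / real N"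
  assumes "j \<in> {1..N}" "k \<in> {1..N}" "l \<in> {1..N}" "m \<in> {1..N}"
  shows "(\<Sum>p=1..N. (\<delta> j p - u) * (\<delta> k p - u) * (\<delta> l p - u) * (\<delta> m p - u))
    = \<delta> j k * \<delta> k l * \<delta> l m
      - u * (\<delta> j k * \<delta> k l + \<delta> j k * \<delta> k m + \<delta> j l * \<delta> l m + \<delta> k l * \<delta> l m)
      + u^2 * (\<delta> j k + \<delta> j l + \<delta> j m + \<delta> k l + \<delta> k m + \<delta> l m) - 3 * u^3"
proof -
  have N: "real N \<noteq> 0" using assms by auto
  have Nu: "real N * u = 1" using N by (simp add: u_def)
  have "(\<Sum>p=1..N. (\<delta> j p - u) * ((\<delta> k p - u) * (\<delta> l p - u) * (\<delta> m p - u)))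
      = (\<delta> k j - u) * (\<delta> l j - u) * (\<delta> m j - u)
        - (\<Sum>p=1..N. (\<delta> k p - u) * ((\<delta> l p - u) * (\<delta> m p - u))) / real N"
    using sum_centering_mult[OF assms(3), of "\<lambda>p. (\<delta> k p - u) * (\<delta> l p - u) * (\<delta> m p - u)"]
    by (simp add: \<delta>_def u_def mult.assoc)
  also have "(\<Sum>p=1..N. (\<delta> k p - u) * ((\<delta> l p - u) * (\<delta> m p - u)))
      = (\<delta> l k - u) * (\<delta> m k - u) - (\<Sum>p=1..N. (\<delta> l p - u) * (\<delta> m p - u)) / real N"
    using sum_centering_mult[OF assms(4), of "\<lambda>p. (\<delta> l p - u) * (\<delta> m p - u)"]
    by (simp add: \<delta>_def u_def)
  also have "(\<Sum>p=1..N. (\<delta> l p - u) * (\<delta> m p - u)) = \<delta> m l - u"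
    using sum_centering_mult[OF assms(5), of "\<lambda>p. \<delta> m p - u"] sum_centering[OF assms(6)]
    by (simp add: \<delta>_def u_def)
  finally have *: "(\<Sum>p=1..N. (\<delta> j p - u) * ((\<delta> k p - u) * (\<delta> l p - u) * (\<delta> m p - u)))
      = (\<delta> k j - u) * (\<delta> l j - u) * (\<delta> m j - u)
        - u * ((\<delta> l k - u) * (\<delta> m k - u) - u * (\<delta> m l - u))"
    by (simp add: u_def)
  show ?thesis
    unfolding mult.assoc[of "\<delta> j _ - u"] *
    by (cases "j = k"; cases "j = l"; cases "j = m"; cases "k = l"; cases "k = m"; cases "l = m")
       (simp_all add: \<delta>_def algebra_simps power2_eq_square power3_eq_cube)
qed

text \<open>Everything that does not depend on all four indices is annihilated by the centering, so
  that only the coincidences of two disjoint pairs and of all four indices survive.\<close>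

lemma sum_centering_pair_moment:
  fixes j k l m N :: nat and b c e :: real
  defines "H \<equiv> \<lambda>p q. of_bool (p = q) - 1 / real N"
  assumes jklm: "j \<in> {1..N}" "k \<in> {1..N}" "l \<in> {1..N}" "m \<in> {1..N}"
  shows "(\<Sum>p=1..N. \<Sum>q=1..N. \<Sum>r=1..N. \<Sum>s=1..N.
      H j p * H k q * H l r * H m s * pair_moment b c e p q r s)
    = e * H j k * H l m + (b - 2 * c + e) * (H j l * H k m + H j m * H k l)
      + (8 * c - 2 * b - 6 * e) * (\<Sum>p=1..N. H j p * H k p * H l p * H m p)"
proof -
  define \<delta> :: "nat \<Rightarrow> nat \<Rightarrow> real" where "\<delta> = (\<lambda>p q. of_bool (p = q))"
  have H0: "(\<Sum>p=1..N. H i p) = 0" if "i \<in> {1..N}" for i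
    unfolding H_def using sum_centering[OF that] .
  have contract: "(\<Sum>q=1..N. H k q * (\<delta> p q * f q)) = H k p * f p" if "p \<in> {1..N}" for k p f
  proof -
    have "(\<Sum>q=1..N. H k q * (\<delta> p q * f q)) = (\<Sum>q=1..N. if p = q then H k q * f q else 0)"
      by (intro sum.cong) (auto simp: \<delta>_def)
    then show ?thesis using that by simp
  qed
  have contract1: "(\<Sum>q=1..N. H k q * \<delta> p q) = H k p" if "p \<in> {1..N}" for k p
    using contract[OF that, of k "\<lambda>_. 1"] by simp
  \<comment> \<open>\<open>L\<close> contracts a four-index array with rows \<open>j\<close>,
    \<open>k\<close>, \<open>l\<close>, \<open>m\<close> of the centering matrix. It is linear, and
    the nesting lets each summation be carried out separately.\<close>
  define L where "L f = (\<Sum>p=1..N. H j p * (\<Sum>q=1..N. H k q * (\<Sum>r=1..N. H l r * (\<Sum>s=1..N. H m s * f p q r s))))"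
    for f :: "nat \<Rightarrow> nat \<Rightarrow> nat \<Rightarrow> nat \<Rightarrow> real"
  have L_add: "L (\<lambda>p q r s. f p q r s + g p q r s) = L f + L g" for f g
    by (simp add: L_def distrib_left sum.distrib)
  have L_mult: "L (\<lambda>p q r s. a * f p q r s) = a * L f" for a f
    by (simp add: L_def sum_distrib_left mult.left_commute)
  have L4: "L (\<lambda>p q r s. f p q r) = 0" for f
    by (simp only: L_def H0[OF jklm(1)] H0[OF jklm(2)] H0[OF jklm(3)] H0[OF jklm(4)]
        sum_distrib_right[symmetric] mult_zero_left mult_zero_right sum.neutral_const)
  have L3: "L (\<lambda>p q r s. f p q s) = 0" for f
    by (simp only: L_def H0[OF jklm(1)] H0[OF jklm(2)] H0[OF jklm(3)] H0[OF jklm(4)]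
        sum_distrib_right[symmetric] mult_zero_left mult_zero_right sum.neutral_const)
  have L2: "L (\<lambda>p q r s. f p r s) = 0" for f
    by (simp only: L_def H0[OF jklm(1)] H0[OF jklm(2)] H0[OF jklm(3)] H0[OF jklm(4)]
        sum_distrib_right[symmetric] mult_zero_left mult_zero_right sum.neutral_const)
  have L1: "L (\<lambda>p q r s. f q r s) = 0" for f
    by (simp only: L_def H0[OF jklm(1)] H0[OF jklm(2)] H0[OF jklm(3)] H0[OF jklm(4)]
        sum_distrib_right[symmetric] mult_zero_left mult_zero_right sum.neutral_const)
  have Hc: "(\<Sum>p=1..N. H i p * H i' p) = H i i'" if "i \<in> {1..N}" "i' \<in> {1..N}" for i i'
  proof -
    have "(\<Sum>p=1..N. H i p * H i' p) = H i' i"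
      using sum_centering_mult[OF that(1), of "H i'"]
      unfolding H0[OF that(2)] by (simp add: H_def)
    then show ?thesis by (auto simp: H_def)
  qed
  have Lpq: "L (\<lambda>p q r s. \<delta> p q * \<delta> r s) = H j k * H l m"
  proof -
    have "L (\<lambda>p q r s. \<delta> p q * \<delta> r s) = (\<Sum>p=1..N. H j p * (\<Sum>q=1..N. H k q * (\<delta> p q * (\<Sum>r=1..N. H l r * (\<Sum>s=1..N. H m s * (\<delta> r s))))))"
      by (simp add: L_def sum_distrib_left mult.left_commute)
    also have "\<dots> = (\<Sum>p=1..N. H j p * (H k p * (\<Sum>r=1..N. H l r * (H m r))))"
      by (simp add: contract contract1 del: One_nat_def cong: sum.cong_simp)
    also have "\<dots> = (\<Sum>p=1..N. H j p * H k p) * (\<Sum>r=1..N. H l r * H m r)"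
      by (simp add: sum_distrib_right mult.assoc)
    finally show ?thesis using Hc jklm by simp
  qed
  have Lpr: "L (\<lambda>p q r s. \<delta> p r * \<delta> q s) = H j l * H k m"
  proof -
    have "L (\<lambda>p q r s. \<delta> p r * \<delta> q s) = (\<Sum>p=1..N. H j p * (\<Sum>q=1..N. H k q * (\<Sum>r=1..N. H l r * (\<delta> p r * (\<Sum>s=1..N. H m s * (\<delta> q s))))))"
      by (simp add: L_def sum_distrib_left mult.left_commute)
    also have "\<dots> = (\<Sum>p=1..N. H j p * (\<Sum>q=1..N. H k q * (H l p * (H m q))))"
      by (simp add: contract contract1 del: One_nat_def cong: sum.cong_simp)
    also have "\<dots> = (\<Sum>p=1..N. H j p * H l p) * (\<Sum>q=1..N. H k q * H m q)"
      unfolding sum_product by (simp only: sum_distrib_left mult_ac)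
    finally show ?thesis using Hc jklm by simp
  qed
  have Lps: "L (\<lambda>p q r s. \<delta> p s * \<delta> q r) = H j m * H k l"
  proof -
    have "L (\<lambda>p q r s. \<delta> p s * \<delta> q r) = (\<Sum>p=1..N. H j p * (\<Sum>q=1..N. H k q * (\<Sum>r=1..N. H l r * (\<delta> q r * (\<Sum>s=1..N. H m s * (\<delta> p s))))))"
      by (simp add: L_def sum_distrib_left mult_ac)
    also have "\<dots> = (\<Sum>p=1..N. H j p * (\<Sum>q=1..N. H k q * (H l q * (H m p))))"
      by (simp add: contract contract1 del: One_nat_def cong: sum.cong_simp)
    also have "\<dots> = (\<Sum>p=1..N. H j p * H m p) * (\<Sum>q=1..N. H k q * H l q)"
      unfolding sum_product by (simp only: sum_distrib_left mult_ac)
    finally show ?thesis using Hc jklm by simp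
  qed
  have Lall: "L (\<lambda>p q r s. \<delta> p q * \<delta> q r * \<delta> r s) = (\<Sum>p=1..N. H j p * H k p * H l p * H m p)"
  proof -
    have "L (\<lambda>p q r s. \<delta> p q * \<delta> q r * \<delta> r s) = (\<Sum>p=1..N. H j p * (\<Sum>q=1..N. H k q * (\<delta> p q * (\<Sum>r=1..N. H l r * (\<delta> q r * (\<Sum>s=1..N. H m s * (\<delta> r s)))))))"
      by (simp add: L_def sum_distrib_left mult_ac)
    also have "\<dots> = (\<Sum>p=1..N. H j p * (H k p * (H l p * (H m p))))"
      by (simp add: contract contract1 del: One_nat_def cong: sum.cong_simp)
    finally show ?thesis by (simp add: mult.assoc)
  qed
  define \<alpha> where "\<alpha> = c - e"
  \<comment> \<open>Inclusion-exclusion in Kronecker symbols, grouped by the missing index: the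
    first four lines do not contain \<open>s\<close>, \<open>r\<close>, \<open>q\<close>,
    \<open>p\<close> respectively. The last coefficient makes the right-hand side zero when all four
    indices agree.\<close>
  have "pair_moment b c e p q r s =
      (e - e * \<delta> p q + \<alpha> * (\<delta> p r + \<delta> q r - 2 * (\<delta> p q * \<delta> q r)))
    + (\<alpha> * (\<delta> p s + \<delta> q s - 2 * (\<delta> p q * \<delta> q s)))
    + (- e * \<delta> r s - 2 * \<alpha> * (\<delta> p r * \<delta> r s))
    + (- 2 * \<alpha> * (\<delta> q r * \<delta> r s))
    + e * (\<delta> p q * \<delta> r s) + (b - 2 * c + e) * (\<delta> p r * \<delta> q s + \<delta> p s * \<delta> q r)
    + (8 * c - 2 * b - 6 * e) * (\<delta> p q * \<delta> q r * \<delta> r s)" for p q r s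
    by (cases "p = q"; cases "p = r"; cases "p = s"; cases "q = r"; cases "q = s"; cases "r = s")
       (simp_all add: pair_moment_def \<delta>_def \<alpha>_def algebra_simps)
  then have pm: "pair_moment b c e = (\<lambda>p q r s.
      (e - e * \<delta> p q + \<alpha> * (\<delta> p r + \<delta> q r - 2 * (\<delta> p q * \<delta> q r)))
    + (\<alpha> * (\<delta> p s + \<delta> q s - 2 * (\<delta> p q * \<delta> q s)))
    + (- e * \<delta> r s - 2 * \<alpha> * (\<delta> p r * \<delta> r s))
    + (- 2 * \<alpha> * (\<delta> q r * \<delta> r s))
    + e * (\<delta> p q * \<delta> r s) + (b - 2 * c + e) * (\<delta> p r * \<delta> q s + \<delta> p s * \<delta> q r)
    + (8 * c - 2 * b - 6 * e) * (\<delta> p q * \<delta> q r * \<delta> r s))"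
    by (intro ext)
  have "(\<Sum>p=1..N. \<Sum>q=1..N. \<Sum>r=1..N. \<Sum>s=1..N. H j p * H k q * H l r * H m s * pair_moment b c e p q r s)
      = L (pair_moment b c e)"
    by (simp add: L_def sum_distrib_left mult.assoc)
  also have "\<dots> = 0 + 0 + 0 + 0 + e * (H j k * H l m) + (b - 2 * c + e) * (H j l * H k m + H j m * H k l)
      + (8 * c - 2 * b - 6 * e) * (\<Sum>p=1..N. H j p * H k p * H l p * H m p)"
    unfolding pm L_add L_mult L1 L2 L3 L4 Lpq Lpr Lps Lall by simp
  finally show ?thesis by simp
qed

text \<open>Collects the contraction by \<open>b\<close>, \<open>c\<close> and \<open>e\<close>. For
  each pattern of \<open>(j, k, l, m)\<close> the three resulting coefficients are polynomials in
  \<open>1 / N\<close>, namely the tabulated ones divided by \<open>N^4\<close>.\<close>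

lemma sum_centering_pair_moment_class:
  fixes b c e :: real
  defines "H \<equiv> \<lambda>N p q. of_bool (p = q) - 1 / real N"
  assumes jklm: "j \<in> {1..N}" "k \<in> {1..N}" "l \<in> {1..N}" "m \<in> {1..N}"
  defines "\<kappa> \<equiv> pair_class j k l m"
  shows "(\<Sum>p=1..N. \<Sum>q=1..N. \<Sum>r=1..N. \<Sum>s=1..N.
      H N j p * H N k q * H N l r * H N m s * pair_moment b c e p q r s)
    = (coef_b (real N) \<kappa> * b + coef_c (real N) \<kappa> * c + coef_d (real N) \<kappa> * e) / real N ^ 4"
proof -
  define u where "u = 1 / real N"
  have [simp]: "N > 0" using jklm by auto
  have u: "real N / real N ^ 4 = u ^ 3" "(real N)\<^sup>2 / real N ^ 4 = u\<^sup>2"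
    "real N ^ 3 / real N ^ 4 = u" "real N ^ 4 / real N ^ 4 = 1"
    by (simp_all add: u_def power_numeral_reduce)
  have b:
    "coef_b (real N) 1 / real N ^ 4 = 6 * u^3 + 2 * u^2"
    "coef_b (real N) 2 / real N ^ 4 = 6 * u^3 - 2 * u^2 - 2 * u + 1"
    "coef_b (real N) 3 / real N ^ 4 = 6 * u^3 - u"
    "coef_b (real N) 4 / real N ^ 4 = 6 * u^3 - 2 * u^2"
    "coef_b (real N) 5 / real N ^ 4 = 6 * u^3 - 4 * u^2"
    "coef_b (real N) 6 / real N ^ 4 = 6 * u^3"
    "coef_b (real N) 7 / real N ^ 4 = 6 * u^3 - 10 * u^2 + 4 * u"
    by (simp_all add: coef_b_def add_divide_distrib diff_divide_distrib u flip: times_divide_eq_right)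
  have c:
    "coef_c (real N) 1 / real N ^ 4 = - 24 * u^3 - 4 * u^2"
    "coef_c (real N) 2 / real N ^ 4 = - 24 * u^3 + 12 * u^2 + 4 * u - 2"
    "coef_c (real N) 3 / real N ^ 4 = - 24 * u^3 + 4 * u^2 + 2 * u"
    "coef_c (real N) 4 / real N ^ 4 = - 24 * u^3 + 12 * u^2"
    "coef_c (real N) 5 / real N ^ 4 = - 24 * u^3 + 20 * u^2 - 4 * u"
    "coef_c (real N) 6 / real N ^ 4 = - 24 * u^3 + 4 * u^2"
    "coef_c (real N) 7 / real N ^ 4 = - 24 * u^3 + 44 * u^2 - 24 * u + 4"
    by (simp_all add: coef_c_def add_divide_distrib diff_divide_distrib u flip: times_divide_eq_right)
  have d:
    "coef_d (real N) 1 / real N ^ 4 = 18 * u^3 + 3 * u^2"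
    "coef_d (real N) 2 / real N ^ 4 = 18 * u^3 - 9 * u^2 - 2 * u + 1"
    "coef_d (real N) 3 / real N ^ 4 = 18 * u^3 - 3 * u^2 - u"
    "coef_d (real N) 4 / real N ^ 4 = 18 * u^3 - 9 * u^2 - 2 * u + 1"
    "coef_d (real N) 5 / real N ^ 4 = 18 * u^3 - 15 * u^2 + 3 * u"
    "coef_d (real N) 6 / real N ^ 4 = 18 * u^3 - 3 * u^2 - u"
    "coef_d (real N) 7 / real N ^ 4 = 18 * u^3 - 33 * u^2 + 18 * u - 3"
    by (simp_all add: coef_d_def add_divide_distrib diff_divide_distrib u flip: times_divide_eq_right)
  \<comment> \<open>These are the fifteen set partitions of the four indices.\<close>
  consider "j = k" "k = l" "l = m"
    | "j = k" "k = l" "k \<noteq> m"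
    | "j = k" "l = m" "k \<noteq> l"
    | "j = k" "k = m" "k \<noteq> l"
    | "j = k" "k \<noteq> l" "k \<noteq> m" "l \<noteq> m"
    | "l = m" "j = l" "k \<noteq> l"
    | "l = m" "k = l" "j \<noteq> l"
    | "l = m" "j \<noteq> k" "j \<noteq> l" "k \<noteq> l"
    | "j = l" "k = m" "j \<noteq> k"
    | "j = m" "k = l" "j \<noteq> k"
    | "j = l" "j \<noteq> k" "j \<noteq> m" "k \<noteq> m"
    | "k = m" "j \<noteq> k" "j \<noteq> l" "k \<noteq> l"
    | "j = m" "j \<noteq> k" "j \<noteq> l" "k \<noteq> l"
    | "k = l" "j \<noteq> k" "j \<noteq> m" "k \<noteq> m"
    | "j \<noteq> k" "j \<noteq> l" "j \<noteq> m" "k \<noteq> l" "k \<noteq> m" "l \<noteq> m"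
    by blast
  note pattern = this
  define x where "x = H N j k * H N l m"
  define y where "y = H N j l * H N k m + H N j m * H N k l"
  define z where "z = (\<Sum>p=1..N. H N j p * H N k p * H N l p * H N m p)"
  have "y - 2 * z = coef_b (real N) \<kappa> / real N ^ 4 \<and> 8 * z - 2 * y = coef_c (real N) \<kappa> / real N ^ 4
      \<and> x + y - 6 * z = coef_d (real N) \<kappa> / real N ^ 4"
    unfolding x_def y_def z_def H_def sum_centering4[OF jklm]
    unfolding \<kappa>_def u_def[symmetric]
    using pattern
    by cases (simp_all add: pair_class_def b c d algebra_simps power2_eq_square power3_eq_cube
        del: One_nat_def)
  moreover have "e * x + (b - 2 * c + e) * y + (8 * c - 2 * b - 6 * e) * z
      = (y - 2 * z) * b + (8 * z - 2 * y) * c + (x + y - 6 * z) * e"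
    by (simp add: algebra_simps)
  moreover have "(\<Sum>p=1..N. \<Sum>q=1..N. \<Sum>r=1..N. \<Sum>s=1..N.
      H N j p * H N k q * H N l r * H N m s * pair_moment b c e p q r s)
      = e * x + (b - 2 * c + e) * y + (8 * c - 2 * b - 6 * e) * z"
    using sum_centering_pair_moment[OF jklm, of b c e] by (simp add: x_def y_def z_def H_def)
  ultimately show ?thesis
    by (simp add: add_divide_distrib)
qed

section \<open>Moments of exchangeable arrays\<close>

lemma ex_permutes_extending:
  assumes "finite S" "A \<subseteq> S" "f ` A \<subseteq> S" "inj_on f A"
  shows "\<exists>\<pi>. \<pi> permutes S \<and> (\<forall>a\<in>A. \<pi> a = f a)"
proof -
  have fin: "finite A" using assms finite_subset by blast
  \<comment> \<open>The complements of \<open>A\<close> and of its image are equally large, so a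
    bijection between them completes \<open>f\<close> to a permutation.\<close>
  have "card (S - A) = card (S - f ` A)"
    using assms fin by (simp add: card_Diff_subset card_image)
  then obtain g where g: "bij_betw g (S - A) (S - f ` A)"
    using finite_same_card_bij[of "S - A" "S - f ` A"] assms(1) by auto
  define \<pi> where "\<pi> x = (if x \<in> A then f x else if x \<in> S then g x else x)" for x
  have "bij_betw \<pi> A (f ` A)"
    using assms(4) by (subst bij_betw_cong[of _ _ f]) (auto simp: \<pi>_def inj_on_imp_bij_betw)
  moreover have "bij_betw \<pi> (S - A) (S - f ` A)"
    using g by (subst bij_betw_cong[of _ _ g]) (auto simp: \<pi>_def)
  ultimately have "bij_betw \<pi> (A \<union> (S - A)) (f ` A \<union> (S - f ` A))"
    by (rule bij_betw_combine) auto
  moreover have "A \<union> (S - A) = S" "f ` A \<union> (S - f ` A) = S" using assms by auto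
  ultimately have "bij_betw \<pi> S S" by simp
  then have "\<pi> permutes S"
    by (rule bij_imp_permutes) (use assms(2) in \<open>auto simp: \<pi>_def\<close>)
  then show ?thesis by (intro exI[of _ \<pi>]) (simp add: \<pi>_def)
qed

text \<open>Two quadruples with the same coincidences are carried into each other by a permutation
  of \<open>{1..N}\<close>, combined with swaps inside the pairs. Hence the values at
  \<open>1 2 1 2\<close>, \<open>1 2 2 3\<close> and \<open>1 2 3 4\<close> determine all
  others.\<close>

lemma exchangeable_pair_moment:
  fixes t :: "nat \<Rightarrow> nat \<Rightarrow> nat \<Rightarrow> nat \<Rightarrow> real"
  assumes inv: "\<And>\<pi> p q r s. \<pi> permutes {1..N} \<Longrightarrow> p \<in> {1..N} \<Longrightarrow> q \<in> {1..N} \<Longrightarrow> r \<in> {1..N} \<Longrightarrow> s \<in> {1..N} \<Longrightarrow>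
      t (\<pi> p) (\<pi> q) (\<pi> r) (\<pi> s) = t p q r s"
    and sym: "\<And>p q r s. t q p r s = t p q r s" "\<And>p q r s. t p q s r = t p q r s"
    and zero: "\<And>p r s. t p p r s = 0" "\<And>p q r. t p q r r = 0"
    and pqrs: "p \<in> {1..N}" "q \<in> {1..N}" "r \<in> {1..N}" "s \<in> {1..N}"
  shows "t p q r s = pair_moment (t 1 2 1 2) (t 1 2 2 3) (t 1 2 3 4) p q r s"
proof -
  have move: "t (f p) (f q) (f r) (f s) = t p q r s"
    if f: "{p, q, r, s} \<subseteq> {1..N}" "f ` {p, q, r, s} \<subseteq> {1..N}" "inj_on f {p, q, r, s}"
    for f :: "nat \<Rightarrow> nat" and p q r s
  proof -
    obtain \<pi> where "\<pi> permutes {1..N}" "\<forall>a\<in>{p, q, r, s}. \<pi> a = f a"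
      using ex_permutes_extending[OF finite_atLeastAtMost f] by auto
    then show ?thesis using inv[of \<pi> p q r s] f(1) by simp
  qed
  have b: "t p q p q = t 1 2 1 2" if "p \<noteq> q" "p \<in> {1..N}" "q \<in> {1..N}" for p q
  proof -
    \<comment> \<open>Two distinct indices force \<open>N\<close> to be large enough for the
      representatives to be sample indices; the cases of three and four indices below proceed
      likewise.\<close>
    have "2 \<le> N" using card_mono[of "{1..N}" "{p, q}"] that by simp
    then show ?thesis
      using move[of p q p q "\<lambda>x. if x = p then 1 else 2"] that by (simp add: inj_on_def)
  qed
  have c: "t p q q s = t 1 2 2 3"
    if "p \<noteq> q" "p \<noteq> s" "q \<noteq> s" "p \<in> {1..N}" "q \<in> {1..N}" "s \<in> {1..N}" for p q s
  proof -
    have "3 \<le> N" using card_mono[of "{1..N}" "{p, q, s}"] that by simp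
    then show ?thesis
      using move[of p q q s "\<lambda>x. if x = p then 1 else if x = q then 2 else 3"] that
      by (simp add: inj_on_def)
  qed
  have e: "t p q r s = t 1 2 3 4"
    if ne: "p \<noteq> q" "p \<noteq> r" "p \<noteq> s" "q \<noteq> r" "q \<noteq> s" "r \<noteq> s"
      and mem: "p \<in> {1..N}" "q \<in> {1..N}" "r \<in> {1..N}" "s \<in> {1..N}" for p q r s
  proof -
    define f where "f x = (if x = p then 1 else if x = q then 2 else if x = r then 3 else 4 :: nat)" for x :: nat
    have f: "f p = 1" "f q = 2" "f r = 3" "f s = 4"
      using ne by (simp_all add: f_def)
    have "4 \<le> N" using card_mono[of "{1..N}" "{p, q, r, s}"] ne mem by simp
    then have "f ` {p, q, r, s} \<subseteq> {1..N}" by (simp add: f)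
    moreover have "inj_on f {p, q, r, s}" by (simp add: f inj_on_insert ne ne[symmetric])
    ultimately show ?thesis
      using move[of p q r s f] mem by (simp add: f)
  qed
  show ?thesis
  proof (cases "p = q \<or> r = s")
    case True
    then show ?thesis using zero by (auto simp: pair_moment_def)
  next
    case False
    then consider "p = r" "q = s" | "p = s" "q = r" | "p = r" "q \<noteq> s" | "p = s" "q \<noteq> r"
      | "q = r" "p \<noteq> s" | "q = s" "p \<noteq> r"
      | "p \<noteq> r" "p \<noteq> s" "q \<noteq> r" "q \<noteq> s"
      by auto
    then show ?thesis
    proof cases
      case 1
      then show ?thesis using False b[of p q] pqrs by (simp add: pair_moment_def)
    next
      case 2
      then show ?thesis using False b[of p q] sym(2)[of p q p q] pqrs by (simp add: pair_moment_def)
    next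
      case 3
      then show ?thesis
        using False c[of q p s] sym(1)[of q p p s] pqrs by (simp add: pair_moment_def)
    next
      case 4
      then show ?thesis
        using False c[of q p r] sym(1)[of q p p r] sym(2)[of p q p r] pqrs by (simp add: pair_moment_def)
    next
      case 5
      then show ?thesis using False c[of p q s] pqrs by (simp add: pair_moment_def)
    next
      case 6
      then show ?thesis
        using False c[of p q r] sym(2)[of p q q r] pqrs by (simp add: pair_moment_def)
    next
      case 7
      have "t p q r s = t 1 2 3 4"
        using False 7 by (intro e pqrs) auto
      with False 7 show ?thesis unfolding pair_moment_def by auto
    qed
  qed
qed

section \<open>Independence and exchangeability under the conditional law\<close>

text \<open>The probability of a rectangle splits first over the rows and then inside each row. Here
  a row is a whole sample member \<open>l\<close>; the array is regrouped by \<open>i\<close>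
  later.\<close>

lemma (in prob_space) indep_vars_array:
  assumes L: "finite L" "L \<noteq> {}" and I: "finite I" "I \<noteq> {}"
    and rows: "indep_vars (\<lambda>l. \<Pi>\<^sub>M i\<in>I. S i) (\<lambda>l \<omega>. \<lambda>i\<in>I. X l i \<omega>) L"
    and entries: "\<And>l. l \<in> L \<Longrightarrow> indep_vars S (X l) I"
  shows "indep_vars (\<lambda>p. S (snd p)) (\<lambda>p. X (fst p) (snd p)) (L \<times> I)"
proof (subst indep_vars_finite[where E = "\<lambda>p. sets (S (snd p))"])
  show "L \<times> I \<noteq> {}" "finite (L \<times> I)" using L I by auto
  show "\<forall>A\<in>(\<Pi> p\<in>L \<times> I. sets (S (snd p))).
      prob (\<Inter>p\<in>L \<times> I. X (fst p) (snd p) -` A p \<inter> space M)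
      = (\<Prod>p\<in>L \<times> I. prob (X (fst p) (snd p) -` A p \<inter> space M))"
  proof
    fix A assume A: "A \<in> (\<Pi> p\<in>L \<times> I. sets (S (snd p)))"
    then have A': "A (l, i) \<in> sets (S i)" if "l \<in> L" "i \<in> I" for l i
      using that by (auto simp: Pi_iff dest: bspec[of _ _ "(l, i)"])
    define R where "R l = (\<lambda>\<omega>. \<lambda>i\<in>I. X l i \<omega>) -` (\<Pi>\<^sub>E i\<in>I. A (l, i)) \<inter> space M" for l
    have R: "R l = (\<Inter>i\<in>I. X l i -` A (l, i) \<inter> space M)" for l
      using I(2) unfolding R_def by (auto simp: PiE_iff)
    have "(\<Inter>p\<in>L \<times> I. X (fst p) (snd p) -` A p \<inter> space M) = (\<Inter>l\<in>L. R l)"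
      by (auto simp: R)
    then have "prob (\<Inter>p\<in>L \<times> I. X (fst p) (snd p) -` A p \<inter> space M) = prob (\<Inter>l\<in>L. R l)"
      by simp
    also have "\<dots> = (\<Prod>l\<in>L. prob (R l))"
      unfolding R_def using A' I L by (intro indep_varsD_finite[OF rows] sets_PiM_I_finite) auto
    also have "\<dots> = (\<Prod>l\<in>L. \<Prod>i\<in>I. prob (X l i -` A (l, i) \<inter> space M))"
      unfolding R using A' I by (intro prod.cong refl indep_varsD_finite[OF entries]) auto
    also have "\<dots> = (\<Prod>p\<in>L \<times> I. prob (X (fst p) (snd p) -` A p \<inter> space M))"
      by (simp add: prod.cartesian_product case_prod_beta)
    finally show "prob (\<Inter>p\<in>L \<times> I. X (fst p) (snd p) -` A p \<inter> space M)
      = (\<Prod>p\<in>L \<times> I. prob (X (fst p) (snd p) -` A p \<inter> space M))" .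
  qed
  show "random_variable (S (snd p)) (X (fst p) (snd p))" if "p \<in> L \<times> I" for p
    using entries[of "fst p"] that by (auto simp: indep_vars_def)
qed (auto simp: sets.sigma_sets_eq sets.Int_stable sets.space_closed)

text \<open>If \<open>A\<close> is almost sure, then \<open>prob A = 1\<close>, so the same formula
  describes both branches of \<open>law_on\<close> and later arguments need no case
  distinction.\<close>

lemma (in prob_space)
  fixes f :: "'a \<Rightarrow> real"
  assumes [measurable]: "A \<in> events" and pos: "prob A > 0"
  shows prob_space_law_on: "prob_space (law_on M A)"
    and integral_law_on: "f \<in> borel_measurable M \<Longrightarrow>
      (\<integral>\<omega>. f \<omega> \<partial>law_on M A) = (\<integral>\<omega>. f \<omega> * indicator A \<omega> \<partial>M) / prob A"
proof -
  have nz: "emeasure M A \<noteq> 0" using pos by (simp add: emeasure_eq_measure)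
  show "prob_space (law_on M A)"
    unfolding law_on_def using nz prob_space_axioms by (auto intro: prob_space_uniform_measure)
  assume [measurable]: "f \<in> borel_measurable M"
  show "(\<integral>\<omega>. f \<omega> \<partial>law_on M A) = (\<integral>\<omega>. f \<omega> * indicator A \<omega> \<partial>M) / prob A"
  proof (cases "AE \<omega> in M. \<omega> \<in> A")
    case True
    then have "prob A = 1" by (simp add: prob_eq_1)
    moreover have "(\<integral>\<omega>. f \<omega> \<partial>M) = (\<integral>\<omega>. f \<omega> * indicator A \<omega> \<partial>M)"
      using True by (intro integral_cong_AE) (auto elim: eventually_mono)
    ultimately show ?thesis using True by (simp add: law_on_def)
  next
    case False
    have "(\<lambda>\<omega>. indicator A \<omega> / emeasure M A) = (\<lambda>\<omega>. ennreal (indicator A \<omega> / prob A))"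
      using pos by (auto simp: fun_eq_iff emeasure_eq_measure divide_ennreal split: split_indicator simp flip: ennreal_1)
    then have "(\<integral>\<omega>. f \<omega> \<partial>uniform_measure M A) = (\<integral>\<omega>. indicator A \<omega> / prob A * f \<omega> \<partial>M)"
      unfolding uniform_measure_def by (simp add: integral_real_density)
    also have "\<dots> = (\<integral>\<omega>. (f \<omega> * indicator A \<omega>) / prob A \<partial>M)"
      by (simp add: mult.commute)
    finally show ?thesis using False by (simp add: law_on_def)
  qed
qed

lemma sets_law_on [measurable_cong, simp]: "sets (law_on M A) = sets M"
  by (simp add: law_on_def)

lemma (in prob_space) AE_law_on: "A \<in> events \<Longrightarrow> AE \<omega> in law_on M A. \<omega> \<in> A"
  unfolding law_on_def using AE_uniform_measureI[of A M "\<lambda>\<omega>. \<omega> \<in> A"] by auto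

lemma sum_sum_product:
  fixes f g :: "'a \<Rightarrow> 'b \<Rightarrow> 'c :: semiring_0"
  shows "(\<Sum>p\<in>A. \<Sum>q\<in>B. f p q) * (\<Sum>r\<in>A. \<Sum>s\<in>B. g r s)
    = (\<Sum>p\<in>A. \<Sum>q\<in>B. \<Sum>r\<in>A. \<Sum>s\<in>B. f p q * g r s)"
  by (simp only: sum_distrib_right) (simp only: sum_distrib_left)

section \<open>Kernel, normalization and quotient as functions of one component of the
  sample\<close>

definition row_psi ::
  "(nat \<Rightarrow> nat) \<Rightarrow> (nat \<Rightarrow> (nat \<Rightarrow> real) measure) \<Rightarrow> nat \<Rightarrow> nat \<Rightarrow> nat \<Rightarrow> (nat \<Rightarrow> nat \<Rightarrow> real) \<Rightarrow> real" where
  "row_psi d \<rho> i p q y = psi (d i) (\<rho> i) (vdiff (d i) (y p) (y q))"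

definition row_h ::
  "(nat \<Rightarrow> nat) \<Rightarrow> (nat \<Rightarrow> (nat \<Rightarrow> real) measure) \<Rightarrow> nat \<Rightarrow> nat \<Rightarrow> (nat \<Rightarrow> nat \<Rightarrow> real) \<Rightarrow> real" where
  "row_h d \<rho> N i y = 1 / (real N)\<^sup>2 * (\<Sum>p=1..N. \<Sum>q=1..N. row_psi d \<rho> i p q y)"

text \<open>The entry \<open>R\<^sub>i(p, q)\<close>. Where \<open>row_h\<close> vanishes, division
  by zero yields 0, which keeps it bounded everywhere.\<close>

definition row_ratio ::
  "(nat \<Rightarrow> nat) \<Rightarrow> (nat \<Rightarrow> (nat \<Rightarrow> real) measure) \<Rightarrow> nat \<Rightarrow> nat \<Rightarrow> nat \<Rightarrow> nat \<Rightarrow> (nat \<Rightarrow> nat \<Rightarrow> real) \<Rightarrow> real" where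
  "row_ratio d \<rho> N i p q y = row_psi d \<rho> i p q y / row_h d \<rho> N i y"

lemma row_psi_nonneg: "row_psi d \<rho> i p q y \<ge> 0"
  by (simp add: row_psi_def psi_nonneg)

lemma row_psi_le:
  assumes "p \<in> {1..N}" "q \<in> {1..N}"
  shows "row_psi d \<rho> i p q y \<le> (real N)\<^sup>2 * row_h d \<rho> N i y"
proof -
  have "row_psi d \<rho> i p q y \<le> (\<Sum>q=1..N. row_psi d \<rho> i p q y)"
    using assms by (intro member_le_sum) (auto simp: row_psi_nonneg)
  also have "\<dots> \<le> (\<Sum>p=1..N. \<Sum>q=1..N. row_psi d \<rho> i p q y)"
    using assms by (intro member_le_sum[where f = "\<lambda>p. \<Sum>q=1..N. row_psi d \<rho> i p q y"])
      (auto simp: row_psi_nonneg intro!: sum_nonneg)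
  finally show ?thesis using assms by (simp add: row_h_def)
qed

lemma row_h_nonneg: "row_h d \<rho> N i y \<ge> 0"
  unfolding row_h_def by (intro mult_nonneg_nonneg sum_nonneg row_psi_nonneg) simp

text \<open>A nonnegative term is at most the whole sum, which is \<open>N^2 * row_h\<close>. The
  integrability of all quotients below comes from this uniform bound.\<close>

lemma abs_row_ratio_le:
  assumes "p \<in> {1..N}" "q \<in> {1..N}"
  shows "\<bar>row_ratio d \<rho> N i p q y\<bar> \<le> (real N)\<^sup>2"
  using row_psi_le[OF assms, of d \<rho> i y] row_h_nonneg[of d \<rho> N i y] row_psi_nonneg[of d \<rho> i p q y]
  by (cases "row_h d \<rho> N i y = 0") (auto simp: row_ratio_def divide_le_eq)

text \<open>The sum over all ordered pairs is only rearranged. In particular the event that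
  \<open>row_h\<close> is nonzero is invariant under permutations of the sample.\<close>

lemma row_h_permute:
  assumes "\<pi> permutes {1..N}"
  shows "row_h d \<rho> N i (\<lambda>l\<in>{1..N}. y (\<pi> l)) = row_h d \<rho> N i y"
proof -
  have "(\<Sum>p=1..N. \<Sum>q=1..N. row_psi d \<rho> i p q (\<lambda>l\<in>{1..N}. y (\<pi> l)))
      = (\<Sum>p=1..N. \<Sum>q=1..N. row_psi d \<rho> i (\<pi> p) (\<pi> q) y)"
    by (intro sum.cong refl) (simp add: row_psi_def)
  also have "\<dots> = (\<Sum>p=1..N. \<Sum>q=1..N. row_psi d \<rho> i (\<pi> p) q y)"
    by (intro sum.cong refl sum.permute[OF assms, symmetric, unfolded comp_def])
  also have "\<dots> = (\<Sum>p=1..N. \<Sum>q=1..N. row_psi d \<rho> i p q y)"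
    by (rule sum.permute[OF assms, symmetric, unfolded comp_def])
  finally show ?thesis by (simp add: row_h_def)
qed

lemma row_ratio_permute:
  assumes "\<pi> permutes {1..N}" "p \<in> {1..N}" "q \<in> {1..N}"
  shows "row_ratio d \<rho> N i p q (\<lambda>l\<in>{1..N}. y (\<pi> l)) = row_ratio d \<rho> N i (\<pi> p) (\<pi> q) y"
  unfolding row_ratio_def row_h_permute[OF assms(1)] using assms(2,3) by (simp add: row_psi_def)

lemma row_ratio_self [simp]: "row_ratio d \<rho> N i p p y = 0"
  by (simp add: row_ratio_def row_psi_def)

text \<open>\<open>row_h\<close> is the mean of the kernel entries, so the quotients have a
  deterministic total; this fixes their expectation.\<close>

lemma sum_row_ratio:
  assumes "row_h d \<rho> N i y \<noteq> 0"
  shows "(\<Sum>p=1..N. \<Sum>q=1..N. row_ratio d \<rho> N i p q y) = (real N)\<^sup>2"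
proof -
  have "(real N)\<^sup>2 * row_h d \<rho> N i y = (\<Sum>p=1..N. \<Sum>q=1..N. row_psi d \<rho> i p q y)"
    by (cases "N = 0") (simp_all add: row_h_def)
  then show ?thesis
    using assms by (simp add: row_ratio_def field_simps flip: sum_divide_distrib)
qed

section \<open>The sample and the laws of its rows\<close>

locale multivariance_sample = prob_space M
  for M :: "'w measure" +
  fixes n N :: nat and d :: "nat \<Rightarrow> nat" and \<rho> :: "nat \<Rightarrow> (nat \<Rightarrow> real) measure"
    and X :: "nat \<Rightarrow> 'w \<Rightarrow> nat \<Rightarrow> real" and XX :: "nat \<Rightarrow> nat \<Rightarrow> 'w \<Rightarrow> nat \<Rightarrow> real"
  assumes n: "n \<ge> 1" and N: "N \<ge> 2"
    and admissible: "\<And>i. i \<in> {1..n} \<Longrightarrow> admissible_measure (d i) (\<rho> i)"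
    and indep_X: "indep_vars (\<lambda>i. Rd (d i)) X {1..n}"
    and nonconst: "\<And>i. i \<in> {1..n} \<Longrightarrow> \<not> (\<exists>a. AE \<omega> in M. X i \<omega> = a)"
    and indep_XX: "indep_vars (\<lambda>l. \<Pi>\<^sub>M i\<in>{1..n}. Rd (d i)) (\<lambda>l \<omega>. \<lambda>i\<in>{1..n}. XX l i \<omega>) {1..N}"
    and distr_XX: "\<And>l. l \<in> {1..N} \<Longrightarrow>
           distr M (\<Pi>\<^sub>M i\<in>{1..n}. Rd (d i)) (\<lambda>\<omega>. \<lambda>i\<in>{1..n}. XX l i \<omega>)
         = distr M (\<Pi>\<^sub>M i\<in>{1..n}. Rd (d i)) (\<lambda>\<omega>. \<lambda>i\<in>{1..n}. X i \<omega>)"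
begin

abbreviation \<mu> where "\<mu> i \<equiv> distr M (Rd (d i)) (X i)"

abbreviation rows :: "nat \<Rightarrow> (nat \<Rightarrow> nat \<Rightarrow> real) measure" where
  "rows i \<equiv> (\<Pi>\<^sub>M l\<in>{1..N}. Rd (d i))"

text \<open>The sample read by component instead of by member: different rows are independent, and
  the entries of one row are independent and identically distributed.\<close>

definition row :: "nat \<Rightarrow> 'w \<Rightarrow> nat \<Rightarrow> nat \<Rightarrow> real" where
  "row i \<omega> = (\<lambda>l\<in>{1..N}. XX l i \<omega>)"

lemma X_measurable: "i \<in> {1..n} \<Longrightarrow> X i \<in> M \<rightarrow>\<^sub>M Rd (d i)"
  using indep_X by (simp add: indep_vars_def)

lemma XX_measurable:
  assumes "l \<in> {1..N}" "i \<in> {1..n}"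
  shows "XX l i \<in> M \<rightarrow>\<^sub>M Rd (d i)"
proof -
  have "(\<lambda>\<omega>. \<lambda>i\<in>{1..n}. XX l i \<omega>) \<in> M \<rightarrow>\<^sub>M (\<Pi>\<^sub>M i\<in>{1..n}. Rd (d i))"
    using indep_XX assms by (simp add: indep_vars_def)
  from measurable_compose[OF this measurable_component_singleton[OF assms(2)]]
  show ?thesis using assms by simp
qed

lemma distr_XX_component:
  assumes "l \<in> {1..N}" "i \<in> {1..n}"
  shows "distr M (Rd (d i)) (XX l i) = \<mu> i"
proof -
  have component: "distr (distr M (\<Pi>\<^sub>M i\<in>{1..n}. Rd (d i)) (\<lambda>\<omega>. \<lambda>i\<in>{1..n}. Z i \<omega>)) (Rd (d i)) (\<lambda>x. x i)
      = distr M (Rd (d i)) (Z i)"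
    if "\<And>i. i \<in> {1..n} \<Longrightarrow> Z i \<in> M \<rightarrow>\<^sub>M Rd (d i)" for Z
    using assms(2) that by (subst distr_distr) (auto simp: comp_def intro!: measurable_restrict)
  show ?thesis
    using component[of "XX l"] component[of X] distr_XX[OF assms(1)] XX_measurable[OF assms(1)] X_measurable
    by simp
qed

text \<open>Independence of the components says that the joint law is the product of its marginals,
  and each copy shares its joint law with \<open>X\<close>.\<close>

lemma indep_XX_components:
  assumes "l \<in> {1..N}"
  shows "indep_vars (\<lambda>i. Rd (d i)) (XX l) {1..n}"
proof (subst indep_vars_iff_distr_eq_PiM')
  show "{1..n} \<noteq> {}" using n by simp
  have "distr M (\<Pi>\<^sub>M i\<in>{1..n}. Rd (d i)) (\<lambda>\<omega>. \<lambda>i\<in>{1..n}. X i \<omega>) = (\<Pi>\<^sub>M i\<in>{1..n}. \<mu> i)"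
    using indep_X n by (subst (asm) indep_vars_iff_distr_eq_PiM') (auto intro: X_measurable)
  then show "distr M (\<Pi>\<^sub>M i\<in>{1..n}. Rd (d i)) (\<lambda>\<omega>. \<lambda>i\<in>{1..n}. XX l i \<omega>)
      = (\<Pi>\<^sub>M i\<in>{1..n}. distr M (Rd (d i)) (XX l i))"
    unfolding distr_XX[OF assms] by (simp only:, intro PiM_cong) (simp_all add: distr_XX_component[OF assms])
qed (rule XX_measurable[OF assms])

text \<open>All \<open>XX l i\<close> are jointly independent, by independence between members and
  within each member. Grouping them by \<open>i\<close> preserves independence; the map composed
  afterwards only renames the index \<open>(l, i)\<close> to \<open>l\<close>.\<close>

lemma indep_rows: "indep_vars rows row {1..n}"
proof -
  have "indep_vars (\<lambda>p. Rd (d (snd p))) (\<lambda>p. XX (fst p) (snd p)) ({1..N} \<times> {1..n})"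
    using n N indep_XX indep_XX_components by (intro indep_vars_array) auto
  then have "indep_vars (\<lambda>i. \<Pi>\<^sub>M p\<in>{1..N} \<times> {i}. Rd (d (snd p)))
      (\<lambda>i \<omega>. restrict (\<lambda>p. XX (fst p) (snd p) \<omega>) ({1..N} \<times> {i})) {1..n}"
    by (rule indep_vars_restrict) (auto simp: disjoint_family_on_def)
  then have "indep_vars rows (\<lambda>i \<omega>. (\<lambda>z. \<lambda>l\<in>{1..N}. z (l, i))
      (restrict (\<lambda>p. XX (fst p) (snd p) \<omega>) ({1..N} \<times> {i}))) {1..n}"
  proof (rule indep_vars_compose2)
    fix i
    have "(\<lambda>z. z (l, i)) \<in> (\<Pi>\<^sub>M p\<in>{1..N} \<times> {i}. Rd (d (snd p))) \<rightarrow>\<^sub>M Rd (d i)" if "l \<in> {1..N}" for l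
      using measurable_component_singleton[of "(l, i)" "{1..N} \<times> {i}" "\<lambda>p. Rd (d (snd p))"] that by simp
    then show "(\<lambda>z. \<lambda>l\<in>{1..N}. z (l, i)) \<in> (\<Pi>\<^sub>M p\<in>{1..N} \<times> {i}. Rd (d (snd p))) \<rightarrow>\<^sub>M rows i"
      by (rule measurable_restrict)
  qed
  also have "(\<lambda>i \<omega>. (\<lambda>z. \<lambda>l\<in>{1..N}. z (l, i)) (restrict (\<lambda>p. XX (fst p) (snd p) \<omega>) ({1..N} \<times> {i}))) = row"
    by (auto simp: fun_eq_iff row_def)
  finally show ?thesis .
qed

lemma row_measurable: "i \<in> {1..n} \<Longrightarrow> row i \<in> M \<rightarrow>\<^sub>M rows i"
  using indep_rows by (simp add: indep_vars_def)

lemma indep_row: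
  assumes "i \<in> {1..n}"
  shows "indep_vars (\<lambda>_. Rd (d i)) (\<lambda>l. XX l i) {1..N}"
proof -
  have "indep_vars (\<lambda>_. Rd (d i)) (\<lambda>l \<omega>. (\<lambda>x. x i) (\<lambda>i\<in>{1..n}. XX l i \<omega>)) {1..N}"
    using assms by (intro indep_vars_compose2[OF indep_XX] measurable_component_singleton)
  then show ?thesis using assms by simp
qed

lemma distr_row:
  assumes "i \<in> {1..n}"
  shows "distr M (rows i) (row i) = (\<Pi>\<^sub>M l\<in>{1..N}. \<mu> i)"
proof -
  have "distr M (rows i) (row i) = (\<Pi>\<^sub>M l\<in>{1..N}. distr M (Rd (d i)) (XX l i))"
    unfolding row_def[abs_def] using indep_row[OF assms] N
    by (subst (asm) indep_vars_iff_distr_eq_PiM') (auto intro: XX_measurable assms)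
  also have "\<dots> = (\<Pi>\<^sub>M l\<in>{1..N}. \<mu> i)"
    by (intro PiM_cong refl distr_XX_component assms)
  finally show ?thesis .
qed

text \<open>The law of a row is a power of the single measure \<open>\<mu> i\<close>, hence
  invariant under reindexing of the coordinates.\<close>

lemma integral_row_permute:
  fixes g :: "(nat \<Rightarrow> nat \<Rightarrow> real) \<Rightarrow> real"
  assumes i: "i \<in> {1..n}" and \<pi>: "\<pi> permutes {1..N}" and g [measurable]: "g \<in> borel_measurable (rows i)"
  shows "(\<integral>\<omega>. g (\<lambda>l\<in>{1..N}. row i \<omega> (\<pi> l)) \<partial>M) = (\<integral>\<omega>. g (row i \<omega>) \<partial>M)"
proof -
  note [measurable] = row_measurable[OF i] X_measurable[OF i]
  let ?\<Pi> = "\<Pi>\<^sub>M l\<in>{1..N}. \<mu> i"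
  have sets: "sets ?\<Pi> = sets (rows i)" by (intro sets_PiM_cong) auto
  have reindex: "(\<lambda>y. \<lambda>l\<in>{1..N}. y (\<pi> l)) \<in> rows i \<rightarrow>\<^sub>M rows i"
    using permutes_in_image[OF \<pi>] by (intro measurable_restrict measurable_component_singleton) auto
  have distr: "distr ?\<Pi> ?\<Pi> (\<lambda>y. \<lambda>l\<in>{1..N}. y (\<pi> l)) = ?\<Pi>"
    using permutes_in_image[OF \<pi>] permutes_inj_on[OF \<pi>]
    by (intro distr_PiM_reindex prob_space_distr X_measurable i) auto
  have "(\<integral>\<omega>. g (\<lambda>l\<in>{1..N}. row i \<omega> (\<pi> l)) \<partial>M) = (\<integral>y. g (\<lambda>l\<in>{1..N}. y (\<pi> l)) \<partial>?\<Pi>)"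
    unfolding distr_row[OF i, symmetric] 
    by (rule integral_distr[symmetric, OF row_measurable[OF i] measurable_compose[OF reindex g]])
  also have "\<dots> = (\<integral>y. g y \<partial>distr ?\<Pi> ?\<Pi> (\<lambda>y. \<lambda>l\<in>{1..N}. y (\<pi> l)))"
    using reindex g
    by (intro integral_distr[symmetric]) (simp_all only: measurable_cong_sets[OF sets sets]
        measurable_cong_sets[OF sets refl] measurable_cong_sets[OF refl sets])
  also have "\<dots> = (\<integral>y. g y \<partial>?\<Pi>)"
    by (simp only: distr)
  also have "\<dots> = (\<integral>\<omega>. g (row i \<omega>) \<partial>M)"
    unfolding distr_row[OF i, symmetric]
    by (rule integral_distr[OF row_measurable[OF i] g])
  finally show ?thesis .
qed


section \<open>Bounded statistics of a row\<close>

lemma row_psi_measurable [measurable]: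
  assumes "i \<in> {1..n}" "p \<in> {1..N}" "q \<in> {1..N}"
  shows "row_psi d \<rho> i p q \<in> borel_measurable (rows i)"
proof -
  interpret admissible "d i" "\<rho> i" by standard (rule admissible[OF assms(1)])
  have "(\<lambda>y. (y p, y q)) \<in> rows i \<rightarrow>\<^sub>M Rd (d i) \<Otimes>\<^sub>M Rd (d i)"
    using assms by (intro measurable_Pair measurable_component_singleton)
  from measurable_compose[OF measurable_compose[OF this vdiff_measurable] psi_measurable]
  show ?thesis by (simp add: row_psi_def[abs_def])
qed

lemma row_h_measurable: "i \<in> {1..n} \<Longrightarrow> row_h d \<rho> N i \<in> borel_measurable (rows i)"
  unfolding row_h_def[abs_def]
  by (intro borel_measurable_times borel_measurable_sum borel_measurable_const row_psi_measurable)

text \<open>A class closed under the operations that build centered entries; its members are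
  integrable and their products over \<open>i\<close> have factoring expectations.\<close>

definition bounded_statistic :: "nat \<Rightarrow> ((nat \<Rightarrow> nat \<Rightarrow> real) \<Rightarrow> real) \<Rightarrow> bool" where
  "bounded_statistic i g \<longleftrightarrow> g \<in> borel_measurable (rows i) \<and> (\<exists>K. \<forall>y. \<bar>g y\<bar> \<le> K)"

lemma bounded_statistic_const [intro]: "bounded_statistic i (\<lambda>_. a)"
  by (auto simp: bounded_statistic_def)

lemma bounded_statistic_mult [intro]:
  assumes "bounded_statistic i f" "bounded_statistic i g"
  shows "bounded_statistic i (\<lambda>y. f y * g y)"
proof -
  obtain K L where "\<And>y. \<bar>f y\<bar> \<le> K" "\<And>y. \<bar>g y\<bar> \<le> L"
    using assms by (auto simp: bounded_statistic_def)
  then have "\<bar>f y * g y\<bar> \<le> K * L" for y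
    unfolding abs_mult by (intro mult_mono) (auto intro: order_trans[OF abs_ge_zero])
  then show ?thesis using assms by (auto simp: bounded_statistic_def)
qed

lemma bounded_statistic_sum [intro]:
  assumes "\<And>x. x \<in> S \<Longrightarrow> bounded_statistic i (f x)"
  shows "bounded_statistic i (\<lambda>y. \<Sum>x\<in>S. f x y)"
proof -
  obtain K where "\<And>x y. x \<in> S \<Longrightarrow> \<bar>f x y\<bar> \<le> K x"
    using assms unfolding bounded_statistic_def by metis
  then have "\<bar>\<Sum>x\<in>S. f x y\<bar> \<le> (\<Sum>x\<in>S. K x)" for y
    by (intro order_trans[OF sum_abs] sum_mono) auto
  moreover have "(\<lambda>y. \<Sum>x\<in>S. f x y) \<in> borel_measurable (rows i)"
    using assms by (intro borel_measurable_sum) (simp add: bounded_statistic_def)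
  ultimately show ?thesis by (auto simp: bounded_statistic_def)
qed

lemma bounded_statistic_uminus [intro]:
  "bounded_statistic i f \<Longrightarrow> bounded_statistic i (\<lambda>y. - f y)"
  by (auto simp: bounded_statistic_def)

lemma bounded_statistic_row_ratio [intro]:
  "i \<in> {1..n} \<Longrightarrow> p \<in> {1..N} \<Longrightarrow> q \<in> {1..N} \<Longrightarrow> bounded_statistic i (row_ratio d \<rho> N i p q)"
  unfolding bounded_statistic_def row_ratio_def[abs_def]
  using abs_row_ratio_le[of p N q d \<rho> i] row_h_measurable[of i] row_psi_measurable[of i p q]
  by (auto simp: row_ratio_def)

lemma bounded_statistic_indicator:
  assumes "i \<in> {1..n}"
  shows "bounded_statistic i (\<lambda>y. of_bool (row_h d \<rho> N i y \<noteq> 0))"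
proof -
  note [measurable] = row_h_measurable[OF assms]
  have "(\<lambda>y. of_bool (row_h d \<rho> N i y \<noteq> 0) :: real) \<in> borel_measurable (rows i)"
    unfolding of_bool_def by measurable
  then show ?thesis by (auto simp: bounded_statistic_def intro!: exI[of _ 1])
qed

lemma bounded_statistic_integrable:
  assumes "bounded_statistic i g" "i \<in> {1..n}"
  shows "integrable M (\<lambda>\<omega>. g (row i \<omega>))"
proof -
  obtain K where "\<And>y. \<bar>g y\<bar> \<le> K" using assms by (auto simp: bounded_statistic_def)
  moreover have "(\<lambda>\<omega>. g (row i \<omega>)) \<in> borel_measurable M"
    using assms row_measurable by (auto simp: bounded_statistic_def intro: measurable_compose)
  ultimately show ?thesis by (intro integrable_const_bound[of _ K]) auto
qed

lemma expectation_prod: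
  assumes "\<And>i. i \<in> {1..n} \<Longrightarrow> bounded_statistic i (g i)"
  shows "(\<integral>\<omega>. (\<Prod>i=1..n. g i (row i \<omega>)) \<partial>M) = (\<Prod>i=1..n. \<integral>\<omega>. g i (row i \<omega>) \<partial>M)"
proof (rule indep_vars_lebesgue_integral)
  show "indep_vars (\<lambda>_. borel) (\<lambda>i \<omega>. g i (row i \<omega>)) {1..n}"
    using assms by (intro indep_vars_compose2[OF indep_rows]) (auto simp: bounded_statistic_def)
qed (use assms bounded_statistic_integrable in auto)

section \<open>The event that the normalization does not vanish\<close>

lemma sample_h_eq: "sample_h d \<rho> n N (\<lambda>l i. XX l i \<omega>) = (\<Prod>i=1..n. row_h d \<rho> N i (row i \<omega>))"
  and sample_h_comp_eq: "sample_h_comp d \<rho> N (\<lambda>l i. XX l i \<omega>) i = row_h d \<rho> N i (row i \<omega>)"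
  by (simp_all add: sample_h_def sample_h_comp_def row_h_def row_psi_def row_def)

definition nondegenerate :: "'w set" where
  "nondegenerate = {\<omega> \<in> space M. sample_h d \<rho> n N (\<lambda>l i. XX l i \<omega>) \<noteq> 0}"

text \<open>A product is nonzero exactly if all factors are, so conditioning on this event
  conditions each row on an event of its own.\<close>

lemma indicator_nondegenerate:
  "\<omega> \<in> space M \<Longrightarrow>
    indicator nondegenerate \<omega> = (\<Prod>i=1..n. of_bool (row_h d \<rho> N i (row i \<omega>) \<noteq> 0) :: real)"
  by (auto simp: nondegenerate_def sample_h_eq indicator_def)

lemma nondegenerate_events: "nondegenerate \<in> events"
proof -
  have "(\<lambda>\<omega>. \<Prod>i=1..n. row_h d \<rho> N i (row i \<omega>)) \<in> borel_measurable M"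
    by (intro borel_measurable_prod measurable_compose[OF row_measurable row_h_measurable])
  then show ?thesis unfolding nondegenerate_def sample_h_eq by measurable
qed

text \<open>Written as an expectation, the form in which \<open>expectation_prod\<close> delivers
  it.\<close>

definition nondegenerate_prob :: "nat \<Rightarrow> real" where
  "nondegenerate_prob i = (\<integral>\<omega>. of_bool (row_h d \<rho> N i (row i \<omega>) \<noteq> 0) \<partial>M)"

lemma prob_nondegenerate: "prob nondegenerate = (\<Prod>i=1..n. nondegenerate_prob i)"
proof -
  have "prob nondegenerate = (\<integral>\<omega>. indicator nondegenerate \<omega> \<partial>M)"
    using nondegenerate_events sets.sets_into_space by (simp add: Int_absorb2)
  also have "\<dots> = (\<integral>\<omega>. (\<Prod>i=1..n. of_bool (row_h d \<rho> N i (row i \<omega>) \<noteq> 0)) \<partial>M)"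
    by (intro Bochner_Integration.integral_cong refl indicator_nondegenerate)
  finally show ?thesis
    unfolding nondegenerate_prob_def by (simp only: expectation_prod[OF bounded_statistic_indicator])
qed

text \<open>Otherwise the kernel between the first two members would vanish almost surely. Their
  joint law is a product, so for some fixed \<open>x\<close> the kernel between \<open>x\<close> and
  \<open>\<mu> i\<close>-almost every \<open>y\<close> would vanish; by
  \<open>psi_vdiff_eq_0_iff\<close>, \<open>X i\<close> would be almost surely
  \<open>x\<close>.\<close>

lemma nondegenerate_prob_pos:
  assumes i: "i \<in> {1..n}"
  shows "nondegenerate_prob i > 0"
proof (rule ccontr)
  interpret admissible "d i" "\<rho> i" by standard (rule admissible[OF i])
  interpret \<mu>: prob_space "\<mu> i" by (rule prob_space_distr[OF X_measurable[OF i]])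
  interpret pair_sigma_finite "\<mu> i" "\<mu> i" ..
  have one_two: "1 \<in> {1..N}" "2 \<in> {1..N}" using N by auto
  have [measurable]: "XX 1 i \<in> M \<rightarrow>\<^sub>M Rd (d i)" "XX 2 i \<in> M \<rightarrow>\<^sub>M Rd (d i)" "X i \<in> M \<rightarrow>\<^sub>M Rd (d i)"
    using XX_measurable X_measurable i one_two by auto
  have pair_measurable: "(\<lambda>\<omega>. (XX 1 i \<omega>, XX 2 i \<omega>)) \<in> M \<rightarrow>\<^sub>M Rd (d i) \<Otimes>\<^sub>M Rd (d i)"
    by measurable
  assume "\<not> nondegenerate_prob i > 0"
  then have "(\<integral>\<omega>. of_bool (row_h d \<rho> N i (row i \<omega>) \<noteq> 0) \<partial>M) = (0::real)"
    unfolding nondegenerate_prob_def by (intro antisym Bochner_Integration.integral_nonneg) auto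
  then have "AE \<omega> in M. of_bool (row_h d \<rho> N i (row i \<omega>) \<noteq> 0) = (0::real)"
    by (subst (asm) integral_nonneg_eq_0_iff_AE)
      (auto intro: bounded_statistic_integrable[OF bounded_statistic_indicator] i)
  then have zero: "AE \<omega> in M. psi (d i) (\<rho> i) (vdiff (d i) (XX 1 i \<omega>) (XX 2 i \<omega>)) = 0"
  proof (rule eventually_mono)
    fix \<omega> assume "of_bool (row_h d \<rho> N i (row i \<omega>) \<noteq> 0) = (0::real)"
    then have "row_psi d \<rho> i 1 2 (row i \<omega>) = 0"
      using row_psi_le[OF one_two, of d \<rho> i "row i \<omega>"] row_psi_nonneg[of d \<rho> i 1 2 "row i \<omega>"] by auto
    then show "psi (d i) (\<rho> i) (vdiff (d i) (XX 1 i \<omega>) (XX 2 i \<omega>)) = 0"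
      using one_two by (simp add: row_psi_def row_def)
  qed
  have "indep_var (Rd (d i)) (XX 1 i) (Rd (d i)) (XX 2 i)"
  proof -
    have "indep_var (\<Pi>\<^sub>M l\<in>{1}. Rd (d i)) (\<lambda>\<omega>. restrict (\<lambda>l. XX l i \<omega>) {1})
        (\<Pi>\<^sub>M l\<in>{2}. Rd (d i)) (\<lambda>\<omega>. restrict (\<lambda>l. XX l i \<omega>) {2})"
      using one_two by (intro indep_var_restrict[OF indep_row[OF i]]) auto
    then have "indep_var (Rd (d i)) ((\<lambda>y. y 1) \<circ> (\<lambda>\<omega>. restrict (\<lambda>l. XX l i \<omega>) {1}))
        (Rd (d i)) ((\<lambda>y. y 2) \<circ> (\<lambda>\<omega>. restrict (\<lambda>l. XX l i \<omega>) {2}))"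
      by (rule indep_var_compose) (intro measurable_component_singleton; simp)+
    then show ?thesis by (simp add: comp_def)
  qed
  then have pair: "\<mu> i \<Otimes>\<^sub>M \<mu> i = distr M (Rd (d i) \<Otimes>\<^sub>M Rd (d i)) (\<lambda>\<omega>. (XX 1 i \<omega>, XX 2 i \<omega>))"
    using distr_XX_component[OF one_two(1) i] distr_XX_component[OF one_two(2) i]
    by (simp add: indep_var_distribution_eq)
  have "{z \<in> space (Rd (d i) \<Otimes>\<^sub>M Rd (d i)). psi (d i) (\<rho> i) (vdiff (d i) (fst z) (snd z)) = 0}
      \<in> sets (Rd (d i) \<Otimes>\<^sub>M Rd (d i))"
    using measurable_compose[OF vdiff_measurable psi_measurable] by (simp add: split_beta)
  from AE_distr_iff[OF pair_measurable this]
  have "AE z in \<mu> i \<Otimes>\<^sub>M \<mu> i. psi (d i) (\<rho> i) (vdiff (d i) (fst z) (snd z)) = 0"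
    unfolding pair fst_conv snd_conv using zero by (rule iffD2)
  \<comment> \<open>Almost every section of a null set is null; a suitable \<open>x\<close> exists
    because \<open>\<mu> i\<close> is a probability measure.\<close>
  from AE_pair[OF this] have "AE x in \<mu> i. x \<in> space (\<mu> i) \<and>
      (AE y in \<mu> i. psi (d i) (\<rho> i) (vdiff (d i) x y) = 0)"
    by auto
  then obtain x where x: "x \<in> space (Rd (d i))"
      "AE y in \<mu> i. psi (d i) (\<rho> i) (vdiff (d i) x y) = 0"
    using \<mu>.AE_False by (metis (no_types, lifting) eventually_mono space_distr)
  from AE_distrD[OF X_measurable[OF i] x(2)] AE_space
  have "AE \<omega> in M. X i \<omega> = x"
  proof eventually_elim
    case (elim \<omega>)
    then show ?case
      using psi_vdiff_eq_0_iff[OF x(1) measurable_space[OF X_measurable[OF i]]] by auto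
  qed
  then show False using nonconst[OF i] by blast
qed

section \<open>Factorization and exchangeability under the conditional law\<close>

abbreviation P :: "'w measure" where "P \<equiv> law_on M nondegenerate"

lemma prob_nondegenerate_pos: "prob nondegenerate > 0"
  unfolding prob_nondegenerate by (intro prod_pos ballI nondegenerate_prob_pos)

lemma prob_space_P: "prob_space P"
  by (rule prob_space_law_on[OF nondegenerate_events prob_nondegenerate_pos])

lemma AE_row_h_nonzero: "AE \<omega> in P. \<forall>i\<in>{1..n}. row_h d \<rho> N i (row i \<omega>) \<noteq> 0"
  using AE_law_on[OF nondegenerate_events]
  by (rule eventually_mono) (auto simp: nondegenerate_def sample_h_eq)

lemma row_statistic_measurable:
  assumes "bounded_statistic i g" "i \<in> {1..n}"
  shows "(\<lambda>\<omega>. g (row i \<omega>)) \<in> borel_measurable M"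
  using assms by (auto simp: bounded_statistic_def intro: measurable_compose[OF row_measurable])

lemma bounded_statistic_prod_integrable_P:
  assumes g: "\<And>i. i \<in> {1..n} \<Longrightarrow> bounded_statistic i (g i)"
  shows "integrable P (\<lambda>\<omega>. \<Prod>i=1..n. g i (row i \<omega>))"
proof -
  interpret P: prob_space P by (rule prob_space_P)
  obtain K where K: "\<And>i y. i \<in> {1..n} \<Longrightarrow> \<bar>g i y\<bar> \<le> K i"
    using g unfolding bounded_statistic_def by metis
  have "\<bar>\<Prod>i=1..n. g i (row i \<omega>)\<bar> \<le> (\<Prod>i=1..n. K i)" for \<omega>
    unfolding abs_prod using K by (intro prod_mono) auto
  moreover have "(\<lambda>\<omega>. \<Prod>i=1..n. g i (row i \<omega>)) \<in> borel_measurable P"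
    using g by (intro borel_measurable_prod) (auto intro: row_statistic_measurable simp: measurable_cong_sets[OF sets_law_on refl])
  ultimately show ?thesis by (intro P.integrable_const_bound) auto
qed

text \<open>Padding with ones reduces a statement about one row to one about products over all
  rows.\<close>

lemma single_factor:
  assumes "i \<in> {1..n}"
  shows "(\<Prod>j=1..n. (if j = i then f j else (1::real))) = f i"
  using assms by (simp add: prod.delta)

lemma bounded_statistic_integrable_P:
  assumes g: "bounded_statistic i g" and i: "i \<in> {1..n}"
  shows "integrable P (\<lambda>\<omega>. g (row i \<omega>))"
proof -
  have "integrable P (\<lambda>\<omega>. \<Prod>j=1..n. (if j = i then g else (\<lambda>_. 1)) (row j \<omega>))"
    using g by (intro bounded_statistic_prod_integrable_P) auto
  also have "(\<lambda>\<omega>. \<Prod>j=1..n. (if j = i then g else (\<lambda>_. 1)) (row j \<omega>)) = (\<lambda>\<omega>. g (row i \<omega>))"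
    using single_factor[OF i, of "\<lambda>j. g (row j _)"] by (simp add: if_distribR cong: if_cong)
  finally show ?thesis .
qed

text \<open>The indicator of the event and its probability are both products over \<open>i\<close>,
  so numerator and denominator of the conditional expectation split simultaneously.\<close>

lemma expectation_prod_P_aux:
  assumes g: "\<And>i. i \<in> {1..n} \<Longrightarrow> bounded_statistic i (g i)"
  shows "(\<integral>\<omega>. (\<Prod>i=1..n. g i (row i \<omega>)) \<partial>P) = (\<Prod>i=1..n.
    (\<integral>\<omega>. g i (row i \<omega>) * of_bool (row_h d \<rho> N i (row i \<omega>) \<noteq> 0) \<partial>M) / nondegenerate_prob i)"
proof -
  have "(\<lambda>\<omega>. \<Prod>i=1..n. g i (row i \<omega>)) \<in> borel_measurable M"
    using g by (intro borel_measurable_prod row_statistic_measurable)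
  then have "(\<integral>\<omega>. (\<Prod>i=1..n. g i (row i \<omega>)) \<partial>P)
      = (\<integral>\<omega>. (\<Prod>i=1..n. g i (row i \<omega>)) * indicator nondegenerate \<omega> \<partial>M) / prob nondegenerate"
    by (rule integral_law_on[OF nondegenerate_events prob_nondegenerate_pos])
  also have "(\<integral>\<omega>. (\<Prod>i=1..n. g i (row i \<omega>)) * indicator nondegenerate \<omega> \<partial>M)
      = (\<integral>\<omega>. (\<Prod>i=1..n. g i (row i \<omega>) * of_bool (row_h d \<rho> N i (row i \<omega>) \<noteq> 0)) \<partial>M)"
    by (intro Bochner_Integration.integral_cong refl) (simp only: indicator_nondegenerate prod.distrib)
  also have "\<dots> = (\<Prod>i=1..n. \<integral>\<omega>. g i (row i \<omega>) * of_bool (row_h d \<rho> N i (row i \<omega>) \<noteq> 0) \<partial>M)"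
    using g bounded_statistic_indicator by (intro expectation_prod bounded_statistic_mult)
  finally show ?thesis
    unfolding prob_nondegenerate prod_dividef .
qed

lemma expectation_P:
  assumes g: "bounded_statistic i g" and i: "i \<in> {1..n}"
  shows "(\<integral>\<omega>. g (row i \<omega>) \<partial>P)
    = (\<integral>\<omega>. g (row i \<omega>) * of_bool (row_h d \<rho> N i (row i \<omega>) \<noteq> 0) \<partial>M) / nondegenerate_prob i"
proof -
  have "(\<integral>\<omega>. g (row i \<omega>) \<partial>P) = (\<integral>\<omega>. (\<Prod>j=1..n. (if j = i then g else (\<lambda>_. 1)) (row j \<omega>)) \<partial>P)"
    using single_factor[OF i, of "\<lambda>j. g (row j _)"] by (simp add: if_distribR cong: if_cong)
  also have "\<dots> = (\<Prod>j=1..n. (\<integral>\<omega>. (if j = i then g else (\<lambda>_. 1)) (row j \<omega>)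
      * of_bool (row_h d \<rho> N j (row j \<omega>) \<noteq> 0) \<partial>M) / nondegenerate_prob j)"
    using g by (intro expectation_prod_P_aux) auto
  also have "\<dots> = (\<Prod>j=1..n. if j = i then (\<integral>\<omega>. g (row j \<omega>)
      * of_bool (row_h d \<rho> N j (row j \<omega>) \<noteq> 0) \<partial>M) / nondegenerate_prob j else 1)"
  \<comment> \<open>Every factor with \<open>j \<noteq> i\<close> is
    \<open>nondegenerate_prob j\<close> divided by itself.\<close>
  proof (intro prod.cong refl)
    fix j assume "j \<in> {1..n}"
    then show "(\<integral>\<omega>. (if j = i then g else (\<lambda>_. 1)) (row j \<omega>)
      * of_bool (row_h d \<rho> N j (row j \<omega>) \<noteq> 0) \<partial>M) / nondegenerate_prob j
      = (if j = i then (\<integral>\<omega>. g (row j \<omega>)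
      * of_bool (row_h d \<rho> N j (row j \<omega>) \<noteq> 0) \<partial>M) / nondegenerate_prob j else 1)"
      using nondegenerate_prob_pos[of j] by (simp add: nondegenerate_prob_def)
  qed
  finally show ?thesis unfolding single_factor[OF i] .
qed

text \<open>Independence of the rows survives the conditioning: by \<open>expectation_P\<close>,
  each factor in \<open>expectation_prod_P_aux\<close> is itself a conditional expectation.\<close>

lemma expectation_prod_P:
  assumes "\<And>i. i \<in> {1..n} \<Longrightarrow> bounded_statistic i (g i)"
  shows "(\<integral>\<omega>. (\<Prod>i=1..n. g i (row i \<omega>)) \<partial>P) = (\<Prod>i=1..n. \<integral>\<omega>. g i (row i \<omega>) \<partial>P)"
proof -
  have "(\<integral>\<omega>. (\<Prod>i=1..n. g i (row i \<omega>)) \<partial>P) = (\<Prod>i=1..n.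
      (\<integral>\<omega>. g i (row i \<omega>) * of_bool (row_h d \<rho> N i (row i \<omega>) \<noteq> 0) \<partial>M) / nondegenerate_prob i)"
    by (rule expectation_prod_P_aux) (rule assms)
  also have "\<dots> = (\<Prod>i=1..n. \<integral>\<omega>. g i (row i \<omega>) \<partial>P)"
    by (intro prod.cong refl expectation_P[symmetric] assms)
  finally show ?thesis .
qed

text \<open>Exchangeability survives as well, since the additional factor in
  \<open>expectation_P\<close> is permutation invariant by \<open>row_h_permute\<close>.\<close>

lemma expectation_P_permute:
  assumes g: "bounded_statistic i g" and g': "bounded_statistic i g'" and i: "i \<in> {1..n}" and \<pi>: "\<pi> permutes {1..N}"
    and "\<And>y. g (\<lambda>l\<in>{1..N}. y (\<pi> l)) = g' y"
  shows "(\<integral>\<omega>. g (row i \<omega>) \<partial>P) = (\<integral>\<omega>. g' (row i \<omega>) \<partial>P)"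
proof -
  have "(\<lambda>y. g y * of_bool (row_h d \<rho> N i y \<noteq> 0)) \<in> borel_measurable (rows i)"
    using bounded_statistic_mult[OF g bounded_statistic_indicator[OF i]] by (simp add: bounded_statistic_def)
  from integral_row_permute[OF i \<pi> this] show ?thesis
    unfolding expectation_P[OF g i] expectation_P[OF g' i] row_h_permute[OF \<pi>] assms(5) by simp
qed

section \<open>Expectations of the normalized kernel\<close>

definition pair_expectation :: "nat \<Rightarrow> nat \<Rightarrow> nat \<Rightarrow> nat \<Rightarrow> nat \<Rightarrow> real" where
  "pair_expectation i p q r s = (\<integral>\<omega>. psi (d i) (\<rho> i) (vdiff (d i) (XX p i \<omega>) (XX q i \<omega>))
     * psi (d i) (\<rho> i) (vdiff (d i) (XX r i \<omega>) (XX s i \<omega>))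
     / (sample_h_comp d \<rho> N (\<lambda>l i. XX l i \<omega>) i)\<^sup>2 \<partial>P)"

text \<open>For indices inside the sample the integrand factors through \<open>row i\<close>. The
  definition refers to \<open>XX\<close> instead, in order to agree with the constants of the
  theorem for every index.\<close>

lemma pair_expectation_eq:
  assumes "p \<in> {1..N}" "q \<in> {1..N}" "r \<in> {1..N}" "s \<in> {1..N}"
  shows "pair_expectation i p q r s
    = (\<integral>\<omega>. row_ratio d \<rho> N i p q (row i \<omega>) * row_ratio d \<rho> N i r s (row i \<omega>) \<partial>P)"
  unfolding pair_expectation_def sample_h_comp_eq row_ratio_def row_psi_def using assms
  by (simp add: row_def power2_eq_square)

text \<open>For \<open>N < 4\<close> some of the three expectations involve vectors outside the sample, but then
  \<^const>\<open>pair_moment\<close> does not use them.\<close>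

lemma pair_expectation_pair_moment:
  assumes i: "i \<in> {1..n}" and pqrs: "p \<in> {1..N}" "q \<in> {1..N}" "r \<in> {1..N}" "s \<in> {1..N}"
  shows "pair_expectation i p q r s = pair_moment (pair_expectation i 1 2 1 2)
    (pair_expectation i 1 2 2 3) (pair_expectation i 1 2 3 4) p q r s"
proof (rule exchangeable_pair_moment[OF _ _ _ _ _ pqrs])
  fix \<pi> p q r s
  assume \<pi>: "\<pi> permutes {1..N}" and pqrs: "p \<in> {1..N}" "q \<in> {1..N}" "r \<in> {1..N}" "s \<in> {1..N}"
  have \<pi>_pqrs: "\<pi> p \<in> {1..N}" "\<pi> q \<in> {1..N}" "\<pi> r \<in> {1..N}" "\<pi> s \<in> {1..N}"
    using pqrs permutes_in_image[OF \<pi>] by auto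
  show "pair_expectation i (\<pi> p) (\<pi> q) (\<pi> r) (\<pi> s) = pair_expectation i p q r s"
    unfolding pair_expectation_eq[OF pqrs] pair_expectation_eq[OF \<pi>_pqrs] using pqrs \<pi>_pqrs i
    by (intro expectation_P_permute[OF _ _ i \<pi>, symmetric, where g = "\<lambda>y. row_ratio d \<rho> N i p q y * row_ratio d \<rho> N i r s y"]
        bounded_statistic_mult bounded_statistic_row_ratio) (simp_all only: row_ratio_permute[OF \<pi>])
qed (simp_all add: pair_expectation_def psi_vdiff_commute)

text \<open>The diagonal is zero, all off-diagonal expectations are equal by exchangeability, and by
  \<open>sum_row_ratio\<close> these \<open>N * (N - 1)\<close> equal values add up to
  \<open>N^2\<close>.\<close>

lemma expectation_row_ratio:
  assumes i: "i \<in> {1..n}" and pq: "p \<in> {1..N}" "q \<in> {1..N}"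
  shows "(\<integral>\<omega>. row_ratio d \<rho> N i p q (row i \<omega>) \<partial>P) = (if p = q then 0 else real N / (real N - 1))"
proof -
  interpret P: prob_space P by (rule prob_space_P)
  define m where "m p q = (\<integral>\<omega>. row_ratio d \<rho> N i p q (row i \<omega>) \<partial>P)" for p q
  have one_two: "1 \<in> {1..N}" "2 \<in> {1..N}" using N by auto
  have m: "m p q = (if p = q then 0 else m 1 2)" if pq: "p \<in> {1..N}" "q \<in> {1..N}" for p q
  proof (cases "p = q")
    case True
    then show ?thesis by (simp add: m_def)
  next
    case False
    obtain \<pi> where \<pi>: "\<pi> permutes {1..N}" "\<forall>a\<in>{1, 2}. \<pi> a = (if a = 1 then p else q)"
      using ex_permutes_extending[of "{1..N}" "{1, 2}" "\<lambda>a. if a = 1 then p else q"] pq one_two False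
      by auto
    have "row_ratio d \<rho> N i 1 2 (\<lambda>l\<in>{1..N}. y (\<pi> l)) = row_ratio d \<rho> N i p q y" for y
      unfolding row_ratio_permute[OF \<pi>(1) one_two] using \<pi>(2) by simp
    then have "m 1 2 = m p q"
      unfolding m_def
      by (intro expectation_P_permute[OF _ _ i \<pi>(1)] bounded_statistic_row_ratio i one_two pq)
    with False show ?thesis by simp
  qed
  have "(\<Sum>p=1..N. \<Sum>q=1..N. m p q) = (\<integral>\<omega>. (\<Sum>p=1..N. \<Sum>q=1..N. row_ratio d \<rho> N i p q (row i \<omega>)) \<partial>P)"
    unfolding m_def
    by (intro has_bochner_integral_integral_eq[symmetric] has_bochner_integral_sum
        has_bochner_integral_integrable bounded_statistic_integrable_P bounded_statistic_row_ratio i)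
  also have "\<dots> = (\<integral>\<omega>. (real N)\<^sup>2 \<partial>P)"
  proof (rule integral_cong_AE)
    show "AE \<omega> in P. (\<Sum>p=1..N. \<Sum>q=1..N. row_ratio d \<rho> N i p q (row i \<omega>)) = (real N)\<^sup>2"
      using AE_row_h_nonzero by (rule eventually_mono) (use i in \<open>simp add: sum_row_ratio del: One_nat_def\<close>)
    show "(\<lambda>\<omega>. \<Sum>p=1..N. \<Sum>q=1..N. row_ratio d \<rho> N i p q (row i \<omega>)) \<in> borel_measurable P"
      using i by (intro borel_measurable_sum borel_measurable_integrable bounded_statistic_integrable_P
          bounded_statistic_row_ratio)
  qed simp
  also have "\<dots> = (real N)\<^sup>2" using P.prob_space by simp
  also have "(\<Sum>p=1..N. \<Sum>q=1..N. m p q) = (\<Sum>p=1..N. (real N - 1) * m 1 2)"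
  proof (rule sum.cong[OF refl])
    fix p assume p: "p \<in> {1..N}"
    have off: "m p q = m 1 2" if "q \<in> {1..N} - {p}" for q
      using m[OF p, of q] that by (simp del: One_nat_def split: if_splits)
    have "(\<Sum>q=1..N. m p q) = m p p + (real (card {1..N}) - 1) * m 1 2"
      by (intro sum_remove1 off p finite_atLeastAtMost)
    then show "(\<Sum>q=1..N. m p q) = (real N - 1) * m 1 2"
      using m[OF p p] by simp
  qed
  finally have "real N * ((real N - 1) * m 1 2) = real N * real N"
    by (simp add: power2_eq_square)
  then have "(real N - 1) * m 1 2 = real N"
    using N by (simp only: mult_cancel_left) simp
  then have "m 1 2 = real N / (real N - 1)"
    using N by (simp add: eq_divide_eq mult.commute)
  then show ?thesis
    using m[OF pq] by (simp add: m_def)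
qed

section \<open>Moments of the centered normalized matrices\<close>

definition normalized_entry :: "nat \<Rightarrow> nat \<Rightarrow> nat \<Rightarrow> (nat \<Rightarrow> nat \<Rightarrow> real) \<Rightarrow> real" where
  "normalized_entry i = (\<lambda>j k y. centered_entry N (\<lambda>p q. row_ratio d \<rho> N i p q y) j k)"

lemma bounded_statistic_normalized_entry:
  "i \<in> {1..n} \<Longrightarrow> bounded_statistic i (normalized_entry i j k)"
  unfolding normalized_entry_def centered_entry_def
  by (intro bounded_statistic_uminus bounded_statistic_sum bounded_statistic_mult
      bounded_statistic_const bounded_statistic_row_ratio)

text \<open>The expected matrix is zero on the diagonal and a constant \<open>m\<close> off it;
  centering it with the sign gives \<open>m * H\<close>, and \<open>m = N / (N - 1)\<close>
  normalizes the diagonal to 1.\<close>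

lemma expectation_normalized_entry:
  assumes i: "i \<in> {1..n}" and jk: "j \<in> {1..N}" "k \<in> {1..N}"
  shows "(\<integral>\<omega>. normalized_entry i j k (row i \<omega>) \<partial>P) = (if j = k then 1 else - 1 / (real N - 1))"
proof -
  define H :: "nat \<Rightarrow> nat \<Rightarrow> real" where "H p q = of_bool (p = q) - 1 / real N" for p q
  define m where "m = real N / (real N - 1)"
  have zero: "(\<Sum>q=1..N. H k q) = 0"
    unfolding H_def by (rule sum_centering[OF jk(2)])
  have "(\<integral>\<omega>. normalized_entry i j k (row i \<omega>) \<partial>P)
      = - (\<Sum>p=1..N. \<Sum>q=1..N. H j p * H k q * (if p = q then 0 else m))"
    unfolding normalized_entry_def centered_entry_def H_def[symmetric] m_def
  proof (intro has_bochner_integral_integral_eq has_bochner_integral_minus has_bochner_integral_sum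
      has_bochner_integral_mult_right)
    fix p q assume pq: "p \<in> {1..N}" "q \<in> {1..N}"
    show "has_bochner_integral P (\<lambda>\<omega>. row_ratio d \<rho> N i p q (row i \<omega>))
        (if p = q then 0 else real N / (real N - 1))"
      unfolding has_bochner_integral_iff expectation_row_ratio[OF i pq]
      by (intro conjI refl bounded_statistic_integrable_P bounded_statistic_row_ratio i pq)
  qed
  \<comment> \<open>The off-diagonal sum is the full sum minus the diagonal term; the full sum
    vanishes because the rows of \<open>H\<close> sum to zero.\<close>
  also have "\<dots> = - (\<Sum>p=1..N. H j p * ((\<Sum>q=1..N. H k q * m) - H k p * m))"
  proof (intro arg_cong[where f = uminus] sum.cong refl)
    fix p assume p: "p \<in> {1..N}"
    have "(\<Sum>q=1..N. H j p * H k q * (if p = q then 0 else m))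
        = (\<Sum>q=1..N. H j p * (H k q * m - (if p = q then H k q * m else 0)))"
      by (intro sum.cong) auto
    then show "(\<Sum>q=1..N. H j p * H k q * (if p = q then 0 else m))
        = H j p * ((\<Sum>q=1..N. H k q * m) - H k p * m)"
      using p by (simp add: sum_subtractf flip: sum_distrib_left)
  qed
  also have "\<dots> = m * (\<Sum>p=1..N. H j p * H k p)"
    unfolding sum_distrib_right[symmetric] zero by (simp add: sum_negf sum_distrib_left mult_ac)
  also have "(\<Sum>p=1..N. H j p * H k p) = H k j"
    using sum_centering_mult[OF jk(1), of "H k"] sum_centering[OF jk(2)] by (simp add: H_def)
  also have "m * H k j = (if j = k then 1 else - 1 / (real N - 1))"
    using N by (cases "j = k") (simp_all add: H_def m_def field_simps)
  finally show ?thesis .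
qed

text \<open>Expands both entries and takes expectations termwise.
  \<open>sum_centering_pair_moment_class\<close> holds for arbitrary reals \<open>b\<close>,
  \<open>c\<close>, \<open>e\<close>, so it also applies when \<open>N < 4\<close> and some of these
  constants involve indices beyond \<open>N\<close>.\<close>

lemma expectation_normalized_entry_mult:
  assumes i: "i \<in> {1..n}" and jklm: "j \<in> {1..N}" "k \<in> {1..N}" "l \<in> {1..N}" "m \<in> {1..N}"
  defines "\<kappa> \<equiv> pair_class j k l m"
  shows "(\<integral>\<omega>. normalized_entry i j k (row i \<omega>) * normalized_entry i l m (row i \<omega>) \<partial>P)
    = (coef_b (real N) \<kappa> * pair_expectation i 1 2 1 2 + coef_c (real N) \<kappa> * pair_expectation i 1 2 2 3
      + coef_d (real N) \<kappa> * pair_expectation i 1 2 3 4) / real N ^ 4"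
proof -
  define H :: "nat \<Rightarrow> nat \<Rightarrow> real" where "H p q = of_bool (p = q) - 1 / real N" for p q
  have "normalized_entry i j k y * normalized_entry i l m y = (\<Sum>p=1..N. \<Sum>q=1..N. \<Sum>r=1..N. \<Sum>s=1..N.
      H j p * H k q * H l r * H m s * (row_ratio d \<rho> N i p q y * row_ratio d \<rho> N i r s y))" for y
    unfolding normalized_entry_def centered_entry_def H_def[symmetric] minus_mult_minus sum_sum_product
    by (intro sum.cong refl) (simp only: mult_ac)
  then have "(\<integral>\<omega>. normalized_entry i j k (row i \<omega>) * normalized_entry i l m (row i \<omega>) \<partial>P)
    = (\<integral>\<omega>. (\<Sum>p=1..N. \<Sum>q=1..N. \<Sum>r=1..N. \<Sum>s=1..N.
      H j p * H k q * H l r * H m s * (row_ratio d \<rho> N i p q (row i \<omega>) * row_ratio d \<rho> N i r s (row i \<omega>))) \<partial>P)"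
    by simp
  also have "\<dots> = (\<Sum>p=1..N. \<Sum>q=1..N. \<Sum>r=1..N. \<Sum>s=1..N. H j p * H k q * H l r * H m s
      * pair_moment (pair_expectation i 1 2 1 2) (pair_expectation i 1 2 2 3) (pair_expectation i 1 2 3 4) p q r s)"
  proof (intro has_bochner_integral_integral_eq has_bochner_integral_sum has_bochner_integral_mult_right)
    fix p q r s assume pqrs: "p \<in> {1..N}" "q \<in> {1..N}" "r \<in> {1..N}" "s \<in> {1..N}"
    show "has_bochner_integral P (\<lambda>\<omega>. row_ratio d \<rho> N i p q (row i \<omega>) * row_ratio d \<rho> N i r s (row i \<omega>))
      (pair_moment (pair_expectation i 1 2 1 2) (pair_expectation i 1 2 2 3) (pair_expectation i 1 2 3 4) p q r s)"
      unfolding has_bochner_integral_iff pair_expectation_pair_moment[OF i pqrs, symmetric] pair_expectation_eq[OF pqrs]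
      using pqrs i
      by (intro conjI refl bounded_statistic_integrable_P[OF bounded_statistic_mult] bounded_statistic_row_ratio)
  qed
  also have "\<dots> = (coef_b (real N) \<kappa> * pair_expectation i 1 2 1 2 + coef_c (real N) \<kappa> * pair_expectation i 1 2 2 3
      + coef_d (real N) \<kappa> * pair_expectation i 1 2 3 4) / real N ^ 4"
    unfolding H_def \<kappa>_def by (rule sum_centering_pair_moment_class[OF jklm])
  finally show ?thesis .
qed

section \<open>The first two moments of the normalized statistic\<close>

definition statistic :: "'w \<Rightarrow> real" where
  "statistic \<omega> = real N * ((sample_multivariance d \<rho> n N (\<lambda>l i. XX l i \<omega>))\<^sup>2
     / sample_h d \<rho> n N (\<lambda>l i. XX l i \<omega>))"

text \<open>Centering is linear, so each factor of the normalization can be moved into the matrix of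
  its component. Where the normalization vanishes, both sides are zero.\<close>

lemma statistic_eq:
  "statistic \<omega> = 1 / real N * (\<Sum>j=1..N. \<Sum>k=1..N. \<Prod>i=1..n. normalized_entry i j k (row i \<omega>))"
proof -
  have "centered_entry N (\<lambda>p q. psi (d i) (\<rho> i) (vdiff (d i) (XX p i \<omega>) (XX q i \<omega>))) j k
      / row_h d \<rho> N i (row i \<omega>) = normalized_entry i j k (row i \<omega>)" for i j k
    unfolding normalized_entry_def centered_entry_def
    by (simp add: row_ratio_def row_psi_def row_def sum_divide_distrib)
  then have "(\<Prod>i=1..n. normalized_entry i j k (row i \<omega>)) = (\<Prod>i=1..n. centered_entry N
      (\<lambda>p q. psi (d i) (\<rho> i) (vdiff (d i) (XX p i \<omega>) (XX q i \<omega>))) j k) / sample_h d \<rho> n N (\<lambda>l i. XX l i \<omega>)" for j k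
    by (simp add: sample_h_eq flip: prod_dividef)
  then show ?thesis
    unfolding statistic_def using N
    by (subst sample_multivariance_squared[OF admissible])
       (auto simp: power2_eq_square simp flip: sum_divide_distrib)
qed

lemma integrable_statistic: "integrable P statistic"
  unfolding statistic_eq[abs_def]
  by (intro integrable_mult_right Bochner_Integration.integrable_sum
      bounded_statistic_prod_integrable_P bounded_statistic_normalized_entry)

text \<open>Each of the \<open>N\<close> pairs with \<open>j = k\<close> contributes 1, each of the
  other \<open>N * (N - 1)\<close> pairs the \<open>n\<close>-th power of
  \<open>- 1 / (N - 1)\<close>.\<close>

lemma expectation_statistic:
  "(\<integral>\<omega>. statistic \<omega> \<partial>P) = 1 + (real N - 1) * (- 1 / (real N - 1)) ^ n"
proof -
  have "(\<integral>\<omega>. statistic \<omega> \<partial>P) = 1 / real N * (\<Sum>j=1..N. \<Sum>k=1..N. (if j = k then 1 else - 1 / (real N - 1)) ^ n)"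
    unfolding statistic_eq[abs_def]
  proof (intro has_bochner_integral_integral_eq has_bochner_integral_sum has_bochner_integral_mult_right)
    fix j k assume jk: "j \<in> {1..N}" "k \<in> {1..N}"
    show "has_bochner_integral P (\<lambda>\<omega>. \<Prod>i=1..n. normalized_entry i j k (row i \<omega>))
        ((if j = k then 1 else - 1 / (real N - 1)) ^ n)"
      unfolding has_bochner_integral_iff
    proof
      show "integrable P (\<lambda>\<omega>. \<Prod>i=1..n. normalized_entry i j k (row i \<omega>))"
        by (intro bounded_statistic_prod_integrable_P bounded_statistic_normalized_entry)
      have "(\<integral>\<omega>. (\<Prod>i=1..n. normalized_entry i j k (row i \<omega>)) \<partial>P)
          = (\<Prod>i=1..n. \<integral>\<omega>. normalized_entry i j k (row i \<omega>) \<partial>P)"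
        by (intro expectation_prod_P bounded_statistic_normalized_entry)
      also have "\<dots> = (\<Prod>i=1..n. if j = k then 1 else - 1 / (real N - 1))"
        by (intro prod.cong refl expectation_normalized_entry jk)
      finally show "(\<integral>\<omega>. (\<Prod>i=1..n. normalized_entry i j k (row i \<omega>)) \<partial>P)
          = (if j = k then 1 else - 1 / (real N - 1)) ^ n"
        by simp
    qed
  qed
  also have "(\<Sum>j=1..N. \<Sum>k=1..N. (if j = k then 1 else - 1 / (real N - 1)) ^ n)
      = (\<Sum>j=1..N. 1 + (real N - 1) * (- 1 / (real N - 1)) ^ n)"
    by (intro sum.cong refl, subst sum_remove1[where c = "(- 1 / (real N - 1)) ^ n"]) auto
  finally show ?thesis using N by simp
qed

lemma statistic_squared_eq:
  "(statistic \<omega>)\<^sup>2 = 1 / (real N)\<^sup>2 * (\<Sum>j=1..N. \<Sum>k=1..N. \<Sum>l=1..N. \<Sum>m=1..N. \<Prod>i=1..n.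
     normalized_entry i j k (row i \<omega>) * normalized_entry i l m (row i \<omega>))"
proof -
  have "(statistic \<omega>)\<^sup>2 = 1 / (real N)\<^sup>2 *
      ((\<Sum>j=1..N. \<Sum>k=1..N. \<Prod>i=1..n. normalized_entry i j k (row i \<omega>))
      * (\<Sum>l=1..N. \<Sum>m=1..N. \<Prod>i=1..n. normalized_entry i l m (row i \<omega>)))"
    by (simp add: statistic_eq power2_eq_square)
  then show ?thesis
    by (simp only: sum_sum_product prod.distrib)
qed

lemma integrable_statistic_squared: "integrable P (\<lambda>\<omega>. (statistic \<omega>)\<^sup>2)"
  unfolding statistic_squared_eq
  by (intro integrable_mult_right Bochner_Integration.integrable_sum bounded_statistic_mult
      bounded_statistic_prod_integrable_P bounded_statistic_normalized_entry)

text \<open>The expectation of each term of the quadruple sum factors over \<open>i\<close> and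
  depends on \<open>(j, k, l, m)\<close> only through \<open>pair_class\<close>;
  \<open>sum_pair_class\<close> groups the equal terms.\<close>

lemma expectation_statistic_squared:
  "(\<integral>\<omega>. (statistic \<omega>)\<^sup>2 \<partial>P) = 1 / (real N)\<^sup>2 * (\<Sum>k=1..7. coef_C (real N) k * (\<Prod>i=1..n.
     (coef_b (real N) k * pair_expectation i 1 2 1 2 + coef_c (real N) k * pair_expectation i 1 2 2 3
       + coef_d (real N) k * pair_expectation i 1 2 3 4) / real N ^ 4))"
proof -
  define g where "g k = (\<Prod>i=1..n. (coef_b (real N) k * pair_expectation i 1 2 1 2
      + coef_c (real N) k * pair_expectation i 1 2 2 3
      + coef_d (real N) k * pair_expectation i 1 2 3 4) / real N ^ 4)" for k
  have "(\<integral>\<omega>. (statistic \<omega>)\<^sup>2 \<partial>P) = 1 / (real N)\<^sup>2 *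
      (\<Sum>j=1..N. \<Sum>k=1..N. \<Sum>l=1..N. \<Sum>m=1..N. g (pair_class j k l m))"
    unfolding statistic_squared_eq
  proof (intro has_bochner_integral_integral_eq has_bochner_integral_sum has_bochner_integral_mult_right)
    fix j k l m assume jklm: "j \<in> {1..N}" "k \<in> {1..N}" "l \<in> {1..N}" "m \<in> {1..N}"
    have bounded: "bounded_statistic i (\<lambda>y. normalized_entry i j k y * normalized_entry i l m y)"
      if "i \<in> {1..n}" for i
      using that by (intro bounded_statistic_mult bounded_statistic_normalized_entry)
    show "has_bochner_integral P
        (\<lambda>\<omega>. \<Prod>i=1..n. normalized_entry i j k (row i \<omega>) * normalized_entry i l m (row i \<omega>))
        (g (pair_class j k l m))"
      unfolding has_bochner_integral_iff
    proof
      show "integrable P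
          (\<lambda>\<omega>. \<Prod>i=1..n. normalized_entry i j k (row i \<omega>) * normalized_entry i l m (row i \<omega>))"
        by (rule bounded_statistic_prod_integrable_P[OF bounded])
      have "(\<integral>\<omega>. (\<Prod>i=1..n. normalized_entry i j k (row i \<omega>) * normalized_entry i l m (row i \<omega>)) \<partial>P)
          = (\<Prod>i=1..n. \<integral>\<omega>. normalized_entry i j k (row i \<omega>) * normalized_entry i l m (row i \<omega>) \<partial>P)"
        by (rule expectation_prod_P[OF bounded])
      also have "\<dots> = g (pair_class j k l m)"
        unfolding g_def by (intro prod.cong refl expectation_normalized_entry_mult jklm)
      finally show "(\<integral>\<omega>. (\<Prod>i=1..n. normalized_entry i j k (row i \<omega>) * normalized_entry i l m (row i \<omega>)) \<partial>P)
          = g (pair_class j k l m)" .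
    qed
  qed
  also have "\<dots> = 1 / (real N)\<^sup>2 * (\<Sum>k=1..7. coef_C (real N) k * g k)"
    by (simp only: sum_pair_class)
  finally show ?thesis unfolding g_def .
qed

end

theorem theorem4p17:
  fixes M :: "'w measure"
    and n N :: nat
    and d :: "nat \<Rightarrow> nat"
    and \<rho> :: "nat \<Rightarrow> (nat \<Rightarrow> real) measure"
    and X :: "nat \<Rightarrow> 'w \<Rightarrow> nat \<Rightarrow> real"
    and XX :: "nat \<Rightarrow> nat \<Rightarrow> 'w \<Rightarrow> nat \<Rightarrow> real"
    and P :: "'w measure"
    and sample :: "'w \<Rightarrow> nat \<Rightarrow> nat \<Rightarrow> nat \<Rightarrow> real"
    and Q :: "'w \<Rightarrow> real"
    and \<psi> :: "nat \<Rightarrow> nat \<Rightarrow> nat \<Rightarrow> 'w \<Rightarrow> real"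
    and h :: "nat \<Rightarrow> 'w \<Rightarrow> real"
    and b c e :: "nat \<Rightarrow> real"
  assumes "n \<ge> 1" and "N \<ge> 2"
    and "prob_space M"
    and "\<And>i. i \<in> {1..n} \<Longrightarrow> admissible_measure (d i) (\<rho> i)"
    and "prob_space.indep_vars M (\<lambda>i. Rd (d i)) X {1..n}"
    and "\<And>i. i \<in> {1..n} \<Longrightarrow> \<not> (\<exists>a. AE \<omega> in M. X i \<omega> = a)"
    and "\<And>i. i \<in> {1..n} \<Longrightarrow> integrable M (\<lambda>\<omega>. (psi (d i) (\<rho> i) (X i \<omega>))\<^sup>2)"
    and "prob_space.indep_vars M (\<lambda>l. \<Pi>\<^sub>M i\<in>{1..n}. Rd (d i))
           (\<lambda>l \<omega>. \<lambda>i\<in>{1..n}. XX l i \<omega>) {1..N}"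
    and "\<And>l. l \<in> {1..N} \<Longrightarrow>
           distr M (\<Pi>\<^sub>M i\<in>{1..n}. Rd (d i)) (\<lambda>\<omega>. \<lambda>i\<in>{1..n}. XX l i \<omega>)
         = distr M (\<Pi>\<^sub>M i\<in>{1..n}. Rd (d i)) (\<lambda>\<omega>. \<lambda>i\<in>{1..n}. X i \<omega>)"
  defines "sample \<equiv> \<lambda>\<omega> l i. XX l i \<omega>"
  defines "P \<equiv> law_on M {\<omega> \<in> space M. sample_h d \<rho> n N (sample \<omega>) \<noteq> 0}"
  defines "Q \<equiv> \<lambda>\<omega>. real N * ((sample_multivariance d \<rho> n N (sample \<omega>))\<^sup>2
                            / sample_h d \<rho> n N (sample \<omega>))"
  defines "\<psi> \<equiv> \<lambda>i j k \<omega>. psi (d i) (\<rho> i) (vdiff (d i) (XX j i \<omega>) (XX k i \<omega>))"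
  defines "h \<equiv> \<lambda>i \<omega>. sample_h_comp d \<rho> N (sample \<omega>) i"
  defines "b \<equiv> \<lambda>i. \<integral>\<omega>. (\<psi> i 1 2 \<omega>)\<^sup>2 / (h i \<omega>)\<^sup>2 \<partial>P"
  defines "c \<equiv> \<lambda>i. \<integral>\<omega>. \<psi> i 1 2 \<omega> * \<psi> i 2 3 \<omega> / (h i \<omega>)\<^sup>2 \<partial>P"
  defines "e \<equiv> \<lambda>i. \<integral>\<omega>. \<psi> i 1 2 \<omega> * \<psi> i 3 4 \<omega> / (h i \<omega>)\<^sup>2 \<partial>P"
  shows "integrable P Q \<and>
         (\<integral>\<omega>. Q \<omega> \<partial>P) = 1 + (real N - 1) * (- 1 / (real N - 1)) ^ n \<and>
         1 + (real N - 1) * (- 1 / (real N - 1)) ^ n = 1 - (- 1 / (real N - 1)) ^ (n - 1) \<and>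
         integrable P (\<lambda>\<omega>. (Q \<omega>)\<^sup>2) \<and>
         (\<integral>\<omega>. (Q \<omega>)\<^sup>2 \<partial>P) =
           1 / (real N)\<^sup>2 * (\<Sum>k=1..7. coef_C (real N) k *
             (\<Prod>i=1..n. (coef_b (real N) k * b i + coef_c (real N) k * c i
                           + coef_d (real N) k * e i) / (real N) ^ 4))"
proof -
  interpret multivariance_sample M n N d \<rho> X XX
    using assms(1-9) by (intro multivariance_sample.intro multivariance_sample_axioms.intro)
  have P: "P = law_on M nondegenerate"
    by (simp add: P_def nondegenerate_def sample_def)
  have Q: "Q = statistic"
    by (simp add: Q_def statistic_def sample_def fun_eq_iff)
  have "b i = pair_expectation i 1 2 1 2" "c i = pair_expectation i 1 2 2 3"
    "e i = pair_expectation i 1 2 3 4" for i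
    by (simp_all add: b_def c_def e_def \<psi>_def h_def sample_def P pair_expectation_def power2_eq_square)
  then have "(\<integral>\<omega>. (Q \<omega>)\<^sup>2 \<partial>P) =
      1 / (real N)\<^sup>2 * (\<Sum>k=1..7. coef_C (real N) k *
        (\<Prod>i=1..n. (coef_b (real N) k * b i + coef_c (real N) k * c i
           + coef_d (real N) k * e i) / (real N) ^ 4))"
    unfolding P Q by (simp only: expectation_statistic_squared)
  \<comment> \<open>Since \<open>n \<ge> 1\<close>, one factor of the power can be split off; it
    cancels \<open>N - 1\<close>, which is nonzero by \<open>N \<ge> 2\<close>, and leaves the minus
    sign.\<close>
  moreover have "1 + (real N - 1) * (- 1 / (real N - 1)) ^ n = 1 - (- 1 / (real N - 1)) ^ (n - 1)"
    using \<open>n \<ge> 1\<close> \<open>N \<ge> 2\<close> by (cases n) auto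
  ultimately show ?thesis
    using integrable_statistic expectation_statistic integrable_statistic_squared
    unfolding P Q by blast
qed

end
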